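(* For any integer $\alpha\geq 3$, the graph $G(\alpha,\alpha)$ is Hamilton-laceable.
   Context: For integers $a_1,a_2\geq 1$, $G(a_1,a_2)$ is the graph whose vertices are all strings of length $n=a_1+a_2$ over $\{1,2\}$ with exactly $a_1$ symbols $1$ and $a_2$ symbols $2$, two strings being adjacent if one arises from the other by swapping the first entry with an entry at some position $2,\ldots,n$ distinct from the first entry. The graph $G(\alpha,\alpha)$ is bipartite, with partition classes given by the value of the first symbol. A bipartite graph is Hamilton-laceable if for any two vertices from the two different partition classes there is a Hamilton path between them. *)

theory Defs
  imports "Graph_Theory.Pair_Digraph" "Graph_Theory.Vertex_Walk"
begin

definition binary_strings :: "nat \<Rightarrow> nat \<Rightarrow> nat list set" where
  "binary_strings a1 a2 =
     {x. length x = a1 + a2 \<and> set x \<subseteq> {1, 2} \<and> count_list x 1 = a1 \<and> count_list x 2 = a2}"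

text \<open>Positions are counted from 0, so the first entry is \<open>x ! 0\<close> and the index \<open>i\<close> ranges
  over the positions after the first. An undirected edge is a pair of opposite arcs.\<close>

definition swap_first :: "nat \<Rightarrow> 'a list \<Rightarrow> 'a list" where
  "swap_first i x = x[0 := x ! i, i := x ! 0]"

definition star_transposition_graph :: "nat \<Rightarrow> nat \<Rightarrow> nat list pair_pre_digraph" where
  "star_transposition_graph a1 a2 =
     \<lparr> pverts = binary_strings a1 a2,
       parcs = {(x, y). x \<in> binary_strings a1 a2 \<and>
                  (\<exists>i\<in>{1..<length x}. x ! i \<noteq> x ! 0 \<and> y = swap_first i x)} \<rparr>"

definition first_symbol_class :: "nat \<Rightarrow> nat \<Rightarrow> nat \<Rightarrow> nat list set" where
  "first_symbol_class a1 a2 s = {x \<in> binary_strings a1 a2. x ! 0 = s}"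

definition bipartite_with :: "('a, 'b) pre_digraph \<Rightarrow> 'a set \<Rightarrow> 'a set \<Rightarrow> bool" where
  "bipartite_with G A B \<longleftrightarrow> graph G \<and> verts G = A \<union> B \<and> A \<inter> B = {} \<and>
     arcs_ends G \<subseteq> A \<times> B \<union> B \<times> A"

definition hamilton_path :: "('a, 'b) pre_digraph \<Rightarrow> 'a \<Rightarrow> 'a vwalk \<Rightarrow> 'a \<Rightarrow> bool" where
  "hamilton_path G u p v \<longleftrightarrow> vpath p G \<and> set p = verts G \<and> hd p = u \<and> last p = v"

definition hamilton_laceable :: "('a, 'b) pre_digraph \<Rightarrow> 'a set \<Rightarrow> 'a set \<Rightarrow> bool" where
  "hamilton_laceable G A B \<longleftrightarrow> bipartite_with G A B \<and>
     (\<forall>u\<in>A. \<forall>v\<in>B. \<exists>p. hamilton_path G u p v)"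

lemma mset_swap_first: "i < length x \<Longrightarrow> mset (swap_first i x) = mset x"
  by (cases "x = []") (auto simp: swap_first_def mset_swap)

lemma swap_first_in_binary_strings:
  assumes "x \<in> binary_strings a1 a2" "i < length x"
  shows "swap_first i x \<in> binary_strings a1 a2"
proof -
  have m: "mset (swap_first i x) = mset x"
    using assms(2) by (rule mset_swap_first)
  have "set (swap_first i x) = set x"
    using m by (rule mset_eq_setD)
  moreover have "count_list (swap_first i x) s = count_list x s" for s
    using m by (metis count_mset)
  ultimately show ?thesis
    using assms(1) by (simp add: binary_strings_def swap_first_def)
qed

lemma length_swap_first [simp]: "length (swap_first i x) = length x"
  by (simp add: swap_first_def)

lemma nth_swap_first:
  assumes "i < length x" "j < length x"
  shows "swap_first i x ! j = (if j = i then x ! 0 else if j = 0 then x ! i else x ! j)"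
proof -
  have "0 < length x"
    using assms by linarith
  then show ?thesis
    using assms by (auto simp: swap_first_def nth_list_update)
qed

lemma swap_first_swap_first:
  assumes "i < length x"
  shows "swap_first i (swap_first i x) = x"
proof (rule nth_equalityI)
  fix j assume "j < length (swap_first i (swap_first i x))"
  then have j: "j < length x" by simp
  then have "0 < length x" by linarith
  then show "swap_first i (swap_first i x) ! j = x ! j"
    using assms j by (simp add: nth_swap_first)
qed simp

lemma finite_binary_strings: "finite (binary_strings a1 a2)"
proof (rule finite_subset)
  show "binary_strings a1 a2 \<subseteq> {x. set x \<subseteq> {1, 2} \<and> length x = a1 + a2}"
    by (auto simp: binary_strings_def)
qed (rule finite_lists_length_eq, simp)

lemma graph_star_transposition_graph: "graph (with_proj (star_transposition_graph a1 a2))"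
proof -
  let ?G = "star_transposition_graph a1 a2"
  have sub: "parcs ?G \<subseteq> pverts ?G \<times> pverts ?G"
    by (auto simp: star_transposition_graph_def swap_first_in_binary_strings)
  have fin: "finite (pverts ?G)"
    by (simp add: star_transposition_graph_def finite_binary_strings)
  have finarcs: "finite (parcs ?G)"
    using sub fin finite_subset by blast
  have sym: "symmetric (with_proj ?G)"
    unfolding symmetric_def
  proof (rule symI)
    fix x y assume "(x, y) \<in> arcs_ends (with_proj ?G)"
    then obtain i where x: "x \<in> binary_strings a1 a2" and i: "1 \<le> i" "i < length x"
      and ne: "x ! i \<noteq> x ! 0" and y: "y = swap_first i x"
      by (auto simp: star_transposition_graph_def)
    have "y \<in> binary_strings a1 a2"
      using x i y swap_first_in_binary_strings by blast
    moreover have "x = swap_first i y"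
      using i y by (simp add: swap_first_swap_first)
    moreover have "0 < length x"
      using i by linarith
    then have "y ! i \<noteq> y ! 0" "i < length y"
      using i ne y by (simp_all add: nth_swap_first)
    ultimately show "(y, x) \<in> arcs_ends (with_proj ?G)"
      using i by (auto simp: star_transposition_graph_def intro!: bexI[of _ i])
  qed
  have irrefl: "x \<noteq> y" if "(x, y) \<in> parcs ?G" for x y
  proof -
    from that obtain i where i: "1 \<le> i" "i < length x"
      and ne: "x ! i \<noteq> x ! 0" and y: "y = swap_first i x"
      by (auto simp: star_transposition_graph_def)
    have "y ! i = x ! 0"
      using i y by (simp add: nth_swap_first)
    with ne show ?thesis by metis
  qed
  show ?thesis
  proof
    fix e assume "e \<in> arcs (with_proj ?G)"
    then have e: "(fst e, snd e) \<in> parcs ?G" by simp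
    show "tail (with_proj ?G) e \<in> verts (with_proj ?G)"
      and "head (with_proj ?G) e \<in> verts (with_proj ?G)"
      using sub e unfolding with_proj_simps by blast+
    show "tail (with_proj ?G) e \<noteq> head (with_proj ?G) e"
      using irrefl[OF e] by simp
  next
    fix e1 e2 assume "arc_to_ends (with_proj ?G) e1 = arc_to_ends (with_proj ?G) e2"
    then show "e1 = e2"
      by (simp add: arc_to_ends_def prod_eq_iff)
  qed (use fin finarcs sym in simp_all)
qed

lemma bipartite_star_transposition_graph:
  assumes "a1 + a2 \<ge> 1"
  shows "bipartite_with (with_proj (star_transposition_graph a1 a2))
           (first_symbol_class a1 a2 1) (first_symbol_class a1 a2 2)"
proof -
  have entry: "x ! i = 1 \<or> x ! i = 2" if "x \<in> binary_strings a1 a2" "i < length x" for x i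
  proof -
    have "x ! i \<in> set x"
      using that(2) by (rule nth_mem)
    moreover have "set x \<subseteq> {1, 2}"
      using that(1) by (simp add: binary_strings_def)
    ultimately show ?thesis by blast
  qed
  have first: "x ! 0 = 1 \<or> x ! 0 = 2" if "x \<in> binary_strings a1 a2" for x
  proof (rule entry[OF that])
    have "length x = a1 + a2"
      using that by (simp add: binary_strings_def)
    then show "0 < length x"
      using assms by linarith
  qed
  have arcs: "(x, y) \<in> first_symbol_class a1 a2 1 \<times> first_symbol_class a1 a2 2 \<union>
                first_symbol_class a1 a2 2 \<times> first_symbol_class a1 a2 1"
    if "(x, y) \<in> parcs (star_transposition_graph a1 a2)" for x y
  proof -
    from that obtain i where x: "x \<in> binary_strings a1 a2" and i: "1 \<le> i" "i < length x"
      and ne: "x ! i \<noteq> x ! 0" and y: "y = swap_first i x"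
      by (auto simp: star_transposition_graph_def)
    have "y \<in> binary_strings a1 a2"
      using x i y swap_first_in_binary_strings by blast
    moreover have "0 < length x"
      using i by linarith
    then have "y ! 0 = x ! i"
      using i y by (simp add: nth_swap_first)
    ultimately show ?thesis
      using x ne first[OF x] entry[OF x i(2)] by (auto simp: first_symbol_class_def)
  qed
  let ?A = "first_symbol_class a1 a2 1" and ?B = "first_symbol_class a1 a2 2"
  have "arcs_ends (with_proj (star_transposition_graph a1 a2)) \<subseteq> ?A \<times> ?B \<union> ?B \<times> ?A"
    unfolding with_proj_simps using arcs by (rule subrelI)
  moreover have "verts (with_proj (star_transposition_graph a1 a2)) = ?A \<union> ?B"
    using first by (auto simp: first_symbol_class_def star_transposition_graph_def)
  moreover have "?A \<inter> ?B = {}"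
    by (auto simp: first_symbol_class_def)
  ultimately show ?thesis
    unfolding bipartite_with_def using graph_star_transposition_graph by blast
qed

end

theory Submission
  imports Defs "HOL-Combinatorics.Permutations"
begin

text \<open>Dropping the first symbol turns \<open>G(n + 1, n + 1)\<close> into the middle levels graph: bit strings of
  length \<open>2 n + 1\<close> with \<open>n\<close> or \<open>n + 1\<close> ones, adjacent if they differ in one bit. Read cyclically as
  parentheses, such a string has one unmatched bit, at some position \<open>s\<close>, followed by a Dyck word
  \<open>w\<close>. Flipping the unmatched bit, and flipping the last returning \<open>1\<close> in \<open>w = u 1 v 0\<close> (which moves
  to \<open>s + 1\<close> and to the rotated word \<open>1 u 0 v\<close>), gives a 2-factor whose cycles correspond to the
  rotation classes of Dyck words, i.e. to plane trees. A hexagon splices the cycle of \<open>u 1 v 1 0 0\<close>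
  into an edge of the cycle of \<open>u 1 v 0 1 0\<close>; since every tree other than the star can be pulled to
  one of smaller area in this way, a path that covers the cycle of the star, and contains one
  prescribed edge, grows to a Hamilton path with the same ends. On the cycle of the star (for the
  complementary pair and odd \<open>n\<close>, together with one further cycle) such paths can be written down
  with ends at every odd Hamming distance. That suffices, because coordinate permutations act
  transitively on the pairs of opposite colours at a given distance.\<close>

section \<open>Dyck words and their rotation\<close>

text \<open>\<open>Arch u v\<close> encodes \<open>u 1 v 0\<close>; \<open>arch_left u v\<close> is the code of \<open>1 u 0 v\<close>.\<close>

datatype dyck = Flat | Arch dyck dyck

fun word :: "dyck \<Rightarrow> bool list" where
  "word Flat = []"
| "word (Arch u v) = word u @ True # word v @ [False]"

fun arch_left :: "dyck \<Rightarrow> dyck \<Rightarrow> dyck" where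
  "arch_left u Flat = Arch Flat u"
| "arch_left u (Arch v w) = Arch (arch_left u v) w"

fun rot :: "dyck \<Rightarrow> dyck" where
  "rot Flat = Flat"
| "rot (Arch u v) = arch_left u v"

fun app :: "dyck \<Rightarrow> dyck \<Rightarrow> dyck" where
  "app u Flat = u"
| "app u (Arch v w) = Arch (app u v) w"

text \<open>Sum of the nesting depths of all arches: closing an arch over \<open>v\<close> lifts
  each of its \<open>size v\<close> arches by one level.\<close>

fun area :: "dyck \<Rightarrow> nat" where
  "area Flat = 0"
| "area (Arch u v) = area u + area v + size v"

text \<open>The code of \<open>(10)^k\<close>: the plane tree in which every edge leaves the
  root.\<close>

fun star :: "nat \<Rightarrow> dyck" where
  "star 0 = Flat"
| "star (Suc k) = Arch (star k) Flat"

lemma word_arch_left [simp]: "word (arch_left u v) = True # word u @ False # word v"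
  by (induction u v rule: arch_left.induct) auto

lemma word_app [simp]: "word (app u v) = word u @ word v"
  by (induction u v rule: app.induct) auto

lemma length_word [simp]: "length (word w) = 2 * size w"
  by (induction w) auto

lemma size_arch_left [simp]: "size (arch_left u v) = Suc (size u + size v)"
  by (induction u v rule: arch_left.induct) auto

lemma size_app [simp]: "size (app u v) = size u + size v"
  by (induction u v rule: app.induct) auto

lemma size_rot [simp]: "size (rot w) = size w"
  by (cases w) auto

lemma size_rot_funpow [simp]: "size ((rot ^^ k) w) = size w"
  by (induction k) auto

lemma size_star [simp]: "size (star k) = k"
  by (induction k) auto

lemma area_app [simp]: "area (app u v) = area u + area v"
  by (induction u v rule: app.induct) auto

lemma app_assoc: "app (app u v) w = app u (app v w)"
  by (induction w) auto

lemma app_Flat_left [simp]: "app Flat u = u"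
  by (induction u) auto

lemma arch_left_app: "arch_left u (app v w) = app (arch_left u v) w"
  by (induction w) auto

lemma arch_left_eq_app: "arch_left u v = app (Arch Flat u) v"
  by (induction v) auto

lemma arch_left_Flat_star [simp]: "arch_left Flat (star k) = star (Suc k)"
  by (induction k) auto

text \<open>Seen as a noncrossing matching of points on a circle, a word is turned by one step under
  \<^const>\<open>rot\<close>; one step per symbol of \<open>v\<close> carries the factor \<open>v\<close> of \<open>u v\<close> to the front.\<close>

lemma rot_funpow_app: "(rot ^^ (2 * size v)) (app u v) = app v u"
proof (induction v arbitrary: u)
  case (Arch a b)
  \<comment> \<open>The steps are grouped as one for the final 0, those for \<open>b\<close>, one
    for the 1 between \<open>a\<close> and \<open>b\<close>, and those for \<open>a\<close>. The
    induction hypotheses carry \<open>b\<close> and \<open>a\<close> to the front.\<close>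
  have "(rot ^^ (2 * size (Arch a b))) (app u (Arch a b))
      = (rot ^^ (2 * size a)) ((rot ^^ Suc (2 * size b)) (rot (Arch (app u a) b)))"
    by (simp add: funpow_add funpow_swap1 ac_simps flip: funpow_Suc_right)
  also have "rot (Arch (app u a) b) = app (Arch Flat (app u a)) b"
    by (simp add: arch_left_eq_app)
  also have "(rot ^^ Suc (2 * size b)) (app (Arch Flat (app u a)) b) = rot (Arch b (app u a))"
    by (simp add: Arch.IH(2))
  also have "rot (Arch b (app u a)) = app (app (Arch Flat b) u) a"
    by (simp add: arch_left_eq_app app_assoc)
  also have "(rot ^^ (2 * size a)) (app (app (Arch Flat b) u) a) = app (Arch a b) u"
    by (simp add: Arch.IH(1) flip: app_assoc)
  finally show ?case .
qed simp

lemma rot_period: "(rot ^^ (2 * size w)) w = w"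
  using rot_funpow_app[of w Flat] by simp

lemma arch_left_neq_Flat [simp]: "arch_left u v \<noteq> Flat" "Flat \<noteq> arch_left u v"
  by (cases v; simp)+

lemma inj_arch_left: "arch_left u v = arch_left u' v' \<Longrightarrow> u = u' \<and> v = v'"
proof (induction v arbitrary: v')
  case Flat
  then show ?case by (cases v') auto
next
  case (Arch a b)
  then show ?case by (cases v') auto
qed

lemma inj_rot: "inj rot"
proof (rule injI)
  fix x y assume "rot x = rot y"
  then show "x = y"
    by (cases x; cases y) (auto dest: inj_arch_left)
qed

text \<open>A Dyck word with a hole at the front of which a Dyck word \<open>p\<close> is already attached; the
  index counts the symbols behind the hole.\<close>

inductive hole :: "nat \<Rightarrow> (dyck \<Rightarrow> dyck) \<Rightarrow> bool" where
  here: "hole 0 (app p)"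
| left: "hole k f \<Longrightarrow> hole (k + 2 * size b + 2) (\<lambda>d. Arch (f d) b)"
| right: "hole k f \<Longrightarrow> hole (Suc k) (\<lambda>d. Arch a (f d))"

lemma hole_arch_left_fst: "hole k f \<Longrightarrow> hole (k + 2 * size v + 1) (\<lambda>d. arch_left (f d) v)"
proof (induction v)
  case Flat
  then show ?case using hole.right[of k f Flat] by simp
next
  case (Arch a b)
  from hole.left[OF Arch.IH(1)[OF Arch.prems], of b] show ?case by (simp add: algebra_simps)
qed

lemma hole_arch_left_snd: "hole k f \<Longrightarrow> hole k (\<lambda>d. arch_left u (f d))"
proof (induction rule: hole.induct)
  case (here p)
  have "(\<lambda>d. arch_left u (app p d)) = app (arch_left u p)"
    by (simp add: arch_left_app)
  then show ?case by (simp add: hole.here)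
next
  case (left k f b)
  then show ?case using hole.left[of k "\<lambda>d. arch_left u (f d)" b] by simp
next
  case (right k f a)
  then show ?case using hole.right[of k f "arch_left u a"] by simp
qed

text \<open>One rotation uses up the last symbol behind the hole and never looks at the filling. The
  index thus counts the rotations after which the filling ends the word.\<close>

lemma hole_rot:
  assumes "hole (Suc k) f"
  shows "hole k (\<lambda>d. rot (f d))"
  using assms
proof cases
  case (left j g b)
  then show ?thesis using hole_arch_left_fst[of j g b] by simp
next
  case (right g a)
  then show ?thesis using hole_arch_left_snd[of k g a] by simp
qed

lemma hole_rot_funpow: "hole k f \<Longrightarrow> \<exists>g. \<forall>d. (rot ^^ k) (f d) = app g d"
proof (induction k arbitrary: f)
  case 0
  then show ?case by cases auto
next
  case (Suc k)
  from Suc.IH[OF hole_rot[OF Suc.prems]] show ?case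
    by (simp add: funpow_swap1)
qed

lemma hole_size: "hole k f \<Longrightarrow> size d = size d' \<Longrightarrow> size (f d) = size (f d')"
  by (induction rule: hole.induct) auto

text \<open>Arches around the hole contribute through the size of the filling only, which is the
  same for both.\<close>

lemma hole_area: "hole k f \<Longrightarrow> size d = size d' \<Longrightarrow> area d < area d' \<Longrightarrow> area (f d) < area (f d')"
proof (induction rule: hole.induct)
  case (right k f a)
  then show ?case using hole_size[of k f d d'] by simp
qed simp_all

text \<open>There is an arch \<open>1 v 10 0\<close> whose inside ends in \<open>10\<close>: passing
  over empty arches and descending into an inside that is not a star ends at an arch whose inside is
  a nonempty star.\<close>

lemma nonstar_hole:
  assumes "w \<noteq> star (size w)"
  shows "\<exists>k f v. hole k f \<and> w = f (Arch Flat (Arch v Flat))"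
  using assms
proof (induction w)
  case (Arch a b)
  show ?case
  proof (cases b)
    case Flat
    then have "a \<noteq> star (size a)" using Arch.prems by auto
    from Arch.IH(1)[OF this] obtain k f v where "hole k f" "a = f (Arch Flat (Arch v Flat))"
      by blast
    then show ?thesis using hole.left[of k f b] by (intro exI) auto
  next
    case (Arch b1 b2)
    show ?thesis
    proof (cases "b = star (size b)")
      case True
      then have "Arch a b = app a (Arch Flat (Arch (star (size b1)) Flat))"
        using Arch by auto
      then show ?thesis using hole.here by blast
    next
      case False
      from \<open>b \<noteq> star (size b) \<Longrightarrow> _\<close>[OF this] obtain k f v
        where "hole k f" "b = f (Arch Flat (Arch v Flat))" by blast
      then show ?thesis using hole.right[of k f a] by (intro exI) auto
    qed
  qed
qed simp

text \<open>Changing the factor \<open>1 v 1 0 0\<close> into \<open>1 v 0 1 0\<close> moves one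
  leaf up a level, so the area drops. Both words have the same symbols around this factor, so the
  same number of rotations brings it to the end, behind a common prefix.\<close>

lemma pull:
  assumes "w \<noteq> star (size w)"
  shows "\<exists>k u v w'. (rot ^^ k) w = Arch u (Arch v Flat) \<and> (rot ^^ k) w' = Arch (Arch u v) Flat
    \<and> size w' = size w \<and> area w' < area w"
proof -
  obtain k f v where f: "hole k f" and w: "w = f (Arch Flat (Arch v Flat))"
    using nonstar_hole[OF assms] by blast
  obtain g where g: "\<And>d. (rot ^^ k) (f d) = app g d"
    using hole_rot_funpow[OF f] by blast
  let ?w' = "f (Arch (Arch Flat v) Flat)"
  have "size ?w' = size w" unfolding w by (rule hole_size[OF f]) simp
  moreover have "area ?w' < area w" unfolding w by (rule hole_area[OF f]) simp_all
  moreover have "(rot ^^ k) w = Arch g (Arch v Flat)" "(rot ^^ k) ?w' = Arch (Arch g v) Flat"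
    by (simp_all add: w g)
  ultimately show ?thesis by blast
qed

section \<open>Heights of bit strings, and recovery of a Dyck word from its code\<close>

definition ht :: "bool list \<Rightarrow> int" where
  "ht xs = (\<Sum>x\<leftarrow>xs. if x then 1 else - 1)"

lemma ht_simps [simp]: "ht [] = 0" "ht (x # xs) = (if x then 1 else - 1) + ht xs"
  "ht (xs @ ys) = ht xs + ht ys"
  by (simp_all add: ht_def)

lemma ht_word [simp]: "ht (word w) = 0"
  by (induction w) auto

lemma ht_word_suffix: "word w = xs @ ys \<Longrightarrow> ht ys \<le> 0"
proof (induction w arbitrary: xs ys)
  case (Arch u v)
  consider as where "word u = xs @ as" "ys = as @ True # word v @ [False]"
    | bs where "xs = word u @ bs" "True # word v @ [False] = bs @ ys"
    using Arch.prems by (auto simp: append_eq_append_conv2)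
  then show ?case
  proof cases
    case 1
    then show ?thesis using Arch.IH(1) by simp
  next
    case 2
    then consider "bs = []" "ys = True # word v @ [False]" | cs where "word v @ [False] = cs @ ys"
      by (cases bs) auto
    then show ?thesis
    proof cases
      case 2
      then have "ys = [] \<or> (\<exists>zs. ys = zs @ [False] \<and> word v = cs @ zs)"
        by (metis append_butlast_last_id append_is_Nil_conv butlast_append last_appendR last_snoc butlast_snoc)
      then show ?thesis using Arch.IH(2) by fastforce
    qed simp
  qed
qed simp

lemma ht_word_prefix: "word w = xs @ ys \<Longrightarrow> ht xs \<ge> 0"
  using ht_word_suffix[of w xs ys] ht_word[of w] by simp

text \<open>If the ones matched with the final 0 stood at different places, one of
  \<open>word v\<close>, \<open>word v'\<close> would have a suffix of height 1, formed by a 1 and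
  the other word.\<close>

lemma inj_word: "word w = word w' \<Longrightarrow> w = w'"
proof (induction w arbitrary: w')
  case Flat
  then show ?case by (cases w') auto
next
  case (Arch u v)
  obtain u' v' where w': "w' = Arch u' v'"
    using Arch.prems by (cases w') auto
  have eq: "word u @ True # word v = word u' @ True # word v'"
    using Arch.prems w' by simp
  obtain as where "word u = word u' @ as \<and> as @ True # word v = True # word v' \<or>
      word u @ as = word u' \<and> True # word v = as @ True # word v'"
    using eq[unfolded append_eq_append_conv2] by blast
  then have "word u = word u' \<and> word v = word v'"
  proof (elim disjE conjE)
    assume *: "word u = word u' @ as" "as @ True # word v = True # word v'"
    show ?thesis
    proof (cases as)
      case (Cons a bs)
      then have "word v' = bs @ True # word v" using * by simp
      from ht_word_suffix[OF this] show ?thesis by simp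
    qed (use * in simp)
  next
    assume *: "word u @ as = word u'" "True # word v = as @ True # word v'"
    show ?thesis
    proof (cases as)
      case (Cons a bs)
      then have "word v = bs @ True # word v'" using * by simp
      from ht_word_suffix[OF this] show ?thesis by simp
    qed (use * in simp)
  qed
  then show ?case using Arch.IH w' by blast
qed

lemma finite_dyck: "finite {w :: dyck. size w = n}"
proof (rule finite_imageD)
  have "word ` {w :: dyck. size w = n} \<subseteq> {xs. set xs \<subseteq> UNIV \<and> length xs = 2 * n}" by auto
  moreover have "finite {xs :: bool list. set xs \<subseteq> UNIV \<and> length xs = 2 * n}"
    by (rule finite_lists_length_eq) simp
  ultimately show "finite (word ` {w :: dyck. size w = n})"
    by (rule finite_subset)
  show "inj_on word {w :: dyck. size w = n}"
    by (rule inj_onI) (rule inj_word)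
qed

section \<open>Strings with one unmatched symbol\<close>

definition adj :: "bool list \<Rightarrow> bool list \<Rightarrow> bool" where
  "adj x y \<longleftrightarrow> (\<exists>p b q. x = p @ b # q \<and> y = p @ (\<not> b) # q)"

lemma adjI: "adj (p @ b # q) (p @ (\<not> b) # q)"
  by (auto simp: adj_def)

lemma adj_sym: "adj x y \<Longrightarrow> adj y x"
  unfolding adj_def by fastforce

lemma adj_commute: "adj x y \<longleftrightarrow> adj y x"
  using adj_sym by blast

lemma adj_rotate1: "adj x y \<Longrightarrow> adj (rotate1 x) (rotate1 y)"
proof -
  assume "adj x y"
  then obtain p b q where xy: "x = p @ b # q" "y = p @ (\<not> b) # q"
    by (auto simp: adj_def)
  show ?thesis
  proof (cases p)
    case Nil
    then show ?thesis using adjI[of q b "[]"] xy by simp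
  next
    case (Cons a r)
    then show ?thesis using adjI[of r b "q @ [a]"] xy by simp
  qed
qed

lemma adj_rotate: "adj x y \<Longrightarrow> adj (rotate s x) (rotate s y)"
  by (induction s) (auto intro: adj_rotate1)

text \<open>\<open>rotate\<close> shifts to the left, so the unmatched bit stands at index
  \<open>-s\<close> modulo the length; the same holds for \<open>high\<close>.\<close>

definition low :: "nat \<Rightarrow> dyck \<Rightarrow> bool list" where
  "low s w = rotate s (False # word w)"

definition high :: "nat \<Rightarrow> dyck \<Rightarrow> bool list" where
  "high s w = rotate s (True # word w)"

lemma length_low [simp]: "length (low s w) = Suc (2 * size w)"
  and length_high [simp]: "length (high s w) = Suc (2 * size w)"
  by (simp_all add: low_def high_def)

lemma low_add: "low (s + t) w = rotate s (low t w)"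
  and high_add: "high (s + t) w = rotate s (high t w)"
  by (simp_all add: low_def high_def rotate_rotate)

lemma low_high_cong:
  assumes "s mod Suc (2 * size w) = t mod Suc (2 * size w)"
  shows "low s w = low t w" "high s w = high t w"
  using assms rotate_conv_mod[of s "False # word w"] rotate_conv_mod[of t "False # word w"]
    rotate_conv_mod[of s "True # word w"] rotate_conv_mod[of t "True # word w"]
  by (simp_all add: low_def high_def)

lemma adj_low_high: "adj (low s w) (high s w)"
  unfolding low_def high_def using adjI[of "[]" False] by (intro adj_rotate) simp

lemma adj_high_low: 
  assumes "w \<noteq> Flat"
  shows "adj (high s w) (low (Suc s) (rot w))"
proof -
  obtain u v where w: "w = Arch u v" using assms by (cases w) auto
  \<comment> \<open>For \<open>w = u 1 v 0\<close>, flipping the second displayed 1 of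
    \<open>1 u 1 v 0\<close> leaves its last 0 unmatched; read cyclically from there, the string is
    \<open>0 1 u 0 v\<close>.\<close>
  have "low 1 (rot w) = (True # word u) @ False # word v @ [False]"
    by (simp add: low_def w)
  moreover have "high 0 w = (True # word u) @ True # word v @ [False]"
    by (simp add: high_def w)
  ultimately have "adj (high 0 w) (low 1 (rot w))"
    using adjI[of "True # word u" True "word v @ [False]"] by simp
  from adj_rotate[OF this, of s] show ?thesis
    by (simp flip: low_add high_add)
qed

lemma word_star_Suc: "word (star (Suc k)) = True # False # word (star k)"
  by (metis arch_left_Flat_star word.simps(1) word_arch_left append_Nil)

text \<open>For \<open>k > 0\<close>, flipping the final 0 of \<open>0 (10)^k\<close> gives a string
  that, read cyclically from its last two symbols, is \<open>1 (10)^k\<close>. These edges become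
  the chords on the cycle of the star.\<close>

lemma adj_low_high_star: "adj (low s (star k)) (high (s + 2) (star k))"
proof (cases k)
  case 0
  then show ?thesis using adjI[of "[]" False "[]"] by (simp add: low_def high_def adj_rotate)
next
  case (Suc j)
  have "high 2 (star k) = (False # word (star j) @ [True]) @ True # []"
    by (simp add: high_def numeral_2_eq_2 Suc word_star_Suc del: star.simps)
  moreover have "low 0 (star k) = (False # word (star j) @ [True]) @ False # []"
    by (simp add: low_def Suc)
  ultimately have "adj (low 0 (star k)) (high 2 (star k))"
    using adjI[of "False # word (star j) @ [True]" False "[]"] by simp
  from adj_rotate[OF this, of s] show ?thesis
    by (simp flip: low_add high_add)
qed

text \<open>The three edges of a hexagon whose other three edges are \<open>adj_high_low\<close> for
  \<open>u 1 v 0 1 0\<close> and \<open>u 1 v 1 0 0\<close> at level \<open>s\<close>, and \<open>adj_low_high\<close> at level \<open>s + 3\<close>.\<close>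

lemma hexagon:
  fixes u v :: dyck
  defines "x \<equiv> Arch u (Arch v Flat)" and "y \<equiv> Arch (Arch u v) Flat"
  shows "adj (high s y) (low (s + 3) ((rot ^^ 3) x))"
    and "adj (high s x) (low (s + 1) (rot y))"
    and "adj (low (s + 1) (rot x)) (high (s + 3) ((rot ^^ 3) x))"
proof -
  have r3: "word ((rot ^^ 3) x) = True # False # True # word u @ False # word v"
    by (simp add: x_def numeral_3_eq_3)
  \<comment> \<open>Up to rotation by \<open>s\<close>, the six vertices of the hexagon are the
    strings \<open>1 u a v b c 0\<close> with one or two ones among the bits \<open>a\<close>,
    \<open>b\<close>, \<open>c\<close>.\<close>
  let ?u = "True # word u" and ?v = "word v"
  have "adj (high 0 y) (low 3 ((rot ^^ 3) x))"
    using adjI[of ?u True "?v @ [False, True, False]"]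
    by (simp add: y_def high_def low_def r3) (simp add: numeral_3_eq_3)
  from adj_rotate[OF this, of s] show "adj (high s y) (low (s + 3) ((rot ^^ 3) x))"
    by (simp flip: low_add high_add)
  have "adj (high 0 x) (low 1 (rot y))"
    using adjI[of "?u @ True # ?v" True "[False, False]"]
    by (simp add: y_def x_def high_def low_def)
  from adj_rotate[OF this, of s] show "adj (high s x) (low (s + 1) (rot y))"
    by (simp flip: low_add high_add)
  have "adj (low 1 (rot x)) (high 3 ((rot ^^ 3) x))"
    using adjI[of "?u @ False # ?v @ [True]" False "[False]"]
    by (simp add: x_def high_def low_def r3 del: funpow.simps) (simp add: numeral_3_eq_3)
  from adj_rotate[OF this, of s] show "adj (low (s + 1) (rot x)) (high (s + 3) ((rot ^^ 3) x))"
    by (simp flip: low_add high_add)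
qed

section \<open>Uniqueness of the unmatched position\<close>

lemma rotate_eqE:
  assumes "rotate s xs = rotate t ys" and "xs \<noteq> []" and "length xs = length ys"
  obtains k where "k < length xs" "xs = rotate k ys" "(s + k) mod length xs = t mod length xs"
proof -
  let ?N = "length xs"
  let ?r = "?N - s mod ?N"
  let ?k = "(?r + t) mod ?N"
  have N: "?N > 0" using assms(2) by simp
  have "s mod ?N < ?N" using N by simp
  then have "(?r + s) mod ?N = 0"
    by (metis add.commute le_add_diff_inverse less_imp_le mod_add_left_eq mod_self)
  then have "xs = rotate ?r (rotate s xs)"
    by (simp add: rotate_rotate)
  also have "\<dots> = rotate ?k ys"
    using rotate_conv_mod[of "?r + t" ys] by (simp add: assms(1,3) rotate_rotate)
  finally have "xs = rotate ?k ys" .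
  moreover have "(s + ?k) mod ?N = t mod ?N"
  proof -
    have "(s + ?k) mod ?N = ((?r + s) mod ?N + t) mod ?N"
      by (simp add: mod_simps ac_simps)
    also have "\<dots> = t mod ?N" using \<open>(?r + s) mod ?N = 0\<close> by simp
    finally show ?thesis .
  qed
  ultimately show ?thesis by (rule that[OF mod_less_divisor[OF N]])
qed

text \<open>Otherwise \<open>word w = xs b ys\<close> and \<open>word w' = ys b xs\<close>. As
  prefixes of one word and suffixes of the other, \<open>xs\<close> and \<open>ys\<close> have
  height 0; then \<open>xs b\<close> and \<open>b ys\<close> force the height of \<open>b\<close> to
  be 0 as well, but it is 1 or -1.\<close>

lemma rotate_Cons_word:
  assumes "b # word w = rotate k (b # word w')" "size w = size w'" "k < Suc (2 * size w)"
  shows "k = 0"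
proof (rule ccontr)
  assume "k \<noteq> 0"
  define ys where "ys = take (k - 1) (word w')"
  define zs where "zs = drop (k - 1) (word w')"
  have w': "word w' = ys @ zs" by (simp add: ys_def zs_def)
  have "rotate k (b # word w') = zs @ b # ys"
    using assms(2,3) \<open>k \<noteq> 0\<close> by (simp add: rotate_drop_take ys_def zs_def drop_Cons' take_Cons')
  then have w: "b # word w = zs @ b # ys" using assms(1) by simp
  have "zs \<noteq> []"
    using assms(2,3) \<open>k \<noteq> 0\<close> by (auto simp: zs_def)
  then obtain xs where zs: "zs = b # xs" and "word w = xs @ b # ys"
    using w by (cases zs) auto
  then have "ht (b # ys) \<le> 0" "ht xs \<ge> 0" "ht (xs @ [b]) \<ge> 0" "ht ys \<le> 0"
    using ht_word_suffix[of w xs "b # ys"] ht_word_prefix[of w xs "b # ys"]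
      ht_word_prefix[of w "xs @ [b]" ys] ht_word_suffix[of w "xs @ [b]" ys] by simp_all
  moreover have "ht ys \<ge> 0" "ht (ys @ [b]) \<ge> 0" "ht xs \<le> 0"
    using w' zs ht_word_prefix[of w' ys "b # xs"] ht_word_prefix[of w' "ys @ [b]" xs]
      ht_word_suffix[of w' "ys @ [b]" xs] by simp_all
  ultimately show False by (cases b) auto
qed

lemma rotate_word_eqD:
  assumes "rotate s (b # word w) = rotate t (b # word w')" "size w = size w'"
  shows "w = w' \<and> s mod Suc (2 * size w) = t mod Suc (2 * size w)"
proof -
  obtain k where k: "k < Suc (2 * size w)" "b # word w = rotate k (b # word w')"
    "(s + k) mod Suc (2 * size w) = t mod Suc (2 * size w)"
    using rotate_eqE[OF assms(1)] assms(2) by auto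
  then have "k = 0" using rotate_Cons_word assms(2) by blast
  then show ?thesis using k inj_word[of w w'] by simp
qed

lemma low_eqD: "low s w = low t w' \<Longrightarrow> size w = size w' \<Longrightarrow>
    w = w' \<and> s mod Suc (2 * size w) = t mod Suc (2 * size w)"
  and high_eqD: "high s w = high t w' \<Longrightarrow> size w = size w' \<Longrightarrow>
    w = w' \<and> s mod Suc (2 * size w) = t mod Suc (2 * size w)"
  unfolding low_def high_def by (rule rotate_word_eqD; simp)+

section \<open>Weights, and existence of an unmatched position\<close>

definition weight :: "bool list \<Rightarrow> nat" where
  "weight xs = count_list xs True"

lemma weight_simps [simp]: "weight [] = 0"
  "weight (x # xs) = of_bool x + weight xs" "weight (xs @ ys) = weight xs + weight ys"
  by (simp_all add: weight_def)

lemma weight_rotate [simp]: "weight (rotate k xs) = weight xs"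
proof (induction k)
  case (Suc k)
  have "weight (rotate1 ys) = weight ys" for ys by (cases ys) simp_all
  with Suc show ?case by simp
qed simp

lemma weight_word [simp]: "weight (word w) = size w"
  by (induction w) auto

lemma weight_low [simp]: "weight (low s w) = size w"
  and weight_high [simp]: "weight (high s w) = Suc (size w)"
  by (simp_all add: low_def high_def)

lemma low_neq_high: "size w = size w' \<Longrightarrow> low s w \<noteq> high t w'"
  by (metis weight_low weight_high n_not_Suc_n)

text \<open>A stack of Dyck words separated by unmatched ones; the first argument is its top.\<close>

fun stack :: "dyck \<Rightarrow> dyck list \<Rightarrow> bool list" where
  "stack w [] = word w"
| "stack w (v # vs) = stack v vs @ True # word w"

text \<open>Bracket matching from left to right: a 1 is pushed on the stack, a 0 closes the topmost
  open 1, or stays unmatched if the stack holds none.\<close>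

lemma parse: "\<exists>zs w vs. xs = concat (map (\<lambda>z. word z @ [False]) zs) @ stack w vs"
proof (induction xs rule: rev_induct)
  case Nil
  have "[] = concat (map (\<lambda>z. word z @ [False]) []) @ stack Flat []" by simp
  then show ?case by blast
next
  case (snoc b xs)
  then obtain zs w vs where xs: "xs = concat (map (\<lambda>z. word z @ [False]) zs) @ stack w vs"
    by blast
  show ?case
  proof (cases b)
    case True
    then have "xs @ [b] = concat (map (\<lambda>z. word z @ [False]) zs) @ stack Flat (w # vs)"
      by (simp add: xs)
    then show ?thesis by blast
  next
    case False
    show ?thesis
    proof (cases vs)
      case Nil
      then have "xs @ [b] = concat (map (\<lambda>z. word z @ [False]) (zs @ [w])) @ stack Flat []"
        using False by (simp add: xs)
      then show ?thesis by blast
    next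
      case (Cons v us)
      have "stack (Arch v w) us = stack v us @ True # word w @ [False]"
        by (cases us) auto
      then have "xs @ [b] = concat (map (\<lambda>z. word z @ [False]) zs) @ stack (Arch v w) us"
        using False Cons by (simp add: xs)
      then show ?thesis by blast
    qed
  qed
qed

text \<open>Wrapping around, each unmatched 0 closes the topmost unmatched 1; equal numbers of both
  leave a Dyck word.\<close>

lemma stack_close:
  "length zs = length vs \<Longrightarrow>
     \<exists>t. stack w vs @ concat (map (\<lambda>z. word z @ [False]) zs) @ word z' = word t"
proof (induction zs arbitrary: w vs)
  case Nil
  then show ?case by (auto intro: exI[of _ "app w z'"])
next
  case (Cons z zs)
  then obtain v us where vs: "vs = v # us" by (cases vs) auto
  have "stack (Arch v (app w z)) us = stack v us @ True # word w @ word z @ [False]"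
    by (cases us) auto
  then show ?case using Cons.IH[of us "Arch v (app w z)"] Cons.prems by (simp add: vs)
qed

lemma ht_stack [simp]: "ht (stack w vs) = int (length vs)"
  by (induction w vs rule: stack.induct) auto

lemma ht_zeros [simp]: "ht (concat (map (\<lambda>z. word z @ [False]) zs)) = - int (length zs)"
  by (induction zs) auto

lemma ht_weight: "ht xs = 2 * int (weight xs) - int (length xs)"
  by (induction xs) auto

text \<open>The height -1 means one more unmatched 0 than unmatched ones. The last of these zeros is
  kept; all the others get matched when the string is read cyclically from it.\<close>

lemma ex_low:
  assumes "length x = Suc (2 * n)" "weight x = n"
  shows "\<exists>s w. size w = n \<and> x = low s w"
proof -
  obtain zs w vs where x: "x = concat (map (\<lambda>z. word z @ [False]) zs) @ stack w vs"
    using parse by blast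
  have "ht x = - 1" using assms by (simp add: ht_weight)
  then have len: "length zs = Suc (length vs)" by (simp add: x)
  then have zs: "zs = butlast zs @ [last zs]" by (metis append_butlast_last_id length_0_conv nat.distinct(1))
  let ?z = "concat (map (\<lambda>z. word z @ [False]) (butlast zs)) @ word (last zs)"
  obtain t where t: "stack w vs @ ?z = word t"
    using stack_close[of "butlast zs" vs w "last zs"] len by auto
  have xz: "x = ?z @ False # stack w vs"
    unfolding x by (subst zs) simp
  then have "rotate (length ?z) x = False # word t"
    by (simp only: rotate_append append_Cons t)
  then have "rotate (length x - length ?z) (False # word t) = rotate (length x) x"
    using xz by (simp add: rotate_rotate ac_simps flip: \<open>rotate (length ?z) x = _\<close>)
  then have "x = low (length x - length ?z) t"
    by (simp add: low_def)
  moreover from this have "length x = Suc (2 * size t)"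
    by (metis length_low)
  then have "size t = n"
    using assms(1) by simp
  ultimately show ?thesis by blast
qed

section \<open>The cycles of the 2-factor\<close>

definition linked :: "'a \<Rightarrow> 'a \<Rightarrow> 'a list \<Rightarrow> bool" where
  "linked p q xs \<longleftrightarrow> (p, q) \<in> set (vwalk_arcs xs) \<or> (q, p) \<in> set (vwalk_arcs xs)"

lemma linked_append1: "linked p q xs \<Longrightarrow> linked p q (xs @ ys)"
  and linked_append2: "linked p q ys \<Longrightarrow> linked p q (xs @ ys)"
  unfolding linked_def by (blast intro: in_set_vwalk_arcs_append1)+

lemma linked_rev: "linked p q (rev xs) \<longleftrightarrow> linked p q xs"
proof -
  have "set (vwalk_arcs (rev xs)) = (set (vwalk_arcs xs))\<inverse>" for xs :: "'a list"
  proof (induction xs)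
    case (Cons x xs)
    then show ?case
      by (cases "xs = []") (auto simp: vwalk_arcs_append last_rev)
  qed simp
  then show ?thesis unfolding linked_def by blast
qed

lemma linked_split:
  assumes "linked p q xs"
  obtains a b ys zs where "xs = ys @ a # b # zs" "(a, b) = (p, q) \<or> (a, b) = (q, p)"
proof -
  have "(a, b) \<in> set (vwalk_arcs xs) \<Longrightarrow> \<exists>ys zs. xs = ys @ a # b # zs" for a b
  proof (induction xs rule: vwalk_arcs.induct)
    case (3 x y xs)
    then show ?case by (fastforce intro: exI[of _ "[]"] exI[of _ "_ # _"])
  qed auto
  then show ?thesis using assms that unfolding linked_def by blast
qed

lemma linked_insert:
  assumes "linked p q (ys @ a # b # zs)" "(p, q) \<noteq> (a, b)" "(p, q) \<noteq> (b, a)" "cs \<noteq> []"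
  shows "linked p q (ys @ a # cs @ b # zs)"
proof -
  have "vwalk_arcs ((ys @ [a]) @ b # zs) = vwalk_arcs (ys @ [a]) @ (a, b) # vwalk_arcs (b # zs)"
    by (subst vwalk_arcs_append) simp_all
  moreover have "vwalk_arcs ((ys @ [a]) @ cs @ b # zs)
      = vwalk_arcs (ys @ [a]) @ (a, hd cs) # vwalk_arcs cs @ (last cs, b) # vwalk_arcs (b # zs)"
    using assms(4) by (subst vwalk_arcs_append; simp add: vwalk_arcs_append)
  ultimately have "set (vwalk_arcs (ys @ a # b # zs)) - {(a, b)} \<subseteq> set (vwalk_arcs (ys @ a # cs @ b # zs))"
    by auto
  then show ?thesis using assms(1-3) unfolding linked_def by blast
qed

lemma successively_adj_rev [simp]: "successively adj (rev xs) \<longleftrightarrow> successively adj xs"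
  by (simp add: adj_commute)

text \<open>The cycle through \<open>low s w\<close> is \<open>lo s w 0, hi s w 0, lo s w 1, hi s w 1, \<dots>\<close>.\<close>

definition lo :: "nat \<Rightarrow> dyck \<Rightarrow> nat \<Rightarrow> bool list" where
  "lo s w i = low (s + i) ((rot ^^ i) w)"

definition hi :: "nat \<Rightarrow> dyck \<Rightarrow> nat \<Rightarrow> bool list" where
  "hi s w i = high (s + i) ((rot ^^ i) w)"

definition trail :: "nat \<Rightarrow> dyck \<Rightarrow> nat \<Rightarrow> nat \<Rightarrow> bool list list" where
  "trail s w i j = concat (map (\<lambda>k. [lo s w k, hi s w k]) [i..<j])"

lemma adj_lo_hi: "adj (lo s w i) (hi s w i)"
  by (simp add: lo_def hi_def adj_low_high)

lemma rot_funpow_neq_Flat: "w \<noteq> Flat \<Longrightarrow> (rot ^^ i) w \<noteq> Flat"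
  by (metis size_rot_funpow dyck.size(3) dyck.size(4) dyck.exhaust add_is_0 Zero_not_Suc add_Suc_right)

lemma adj_hi_lo: "w \<noteq> Flat \<Longrightarrow> adj (hi s w i) (lo s w (Suc i))"
  unfolding lo_def hi_def using adj_high_low[of "(rot ^^ i) w" "s + i"] rot_funpow_neq_Flat by simp

lemma trail_empty [simp]: "j \<le> i \<Longrightarrow> trail s w i j = []"
  by (simp add: trail_def)

lemma trail_eq_Nil [simp]: "trail s w i j = [] \<longleftrightarrow> j \<le> i"
  by (auto simp: trail_def)

lemma trail_append: "i \<le> j \<Longrightarrow> j \<le> k \<Longrightarrow> trail s w i j @ trail s w j k = trail s w i k"
  using upt_add_eq_append[of i j "k - j"] by (simp add: trail_def)

lemma trail_Cons: "i < j \<Longrightarrow> trail s w i j = lo s w i # hi s w i # trail s w (Suc i) j"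
  by (simp add: trail_def upt_conv_Cons)

lemma trail_Suc: "i \<le> j \<Longrightarrow> trail s w i (Suc j) = trail s w i j @ [lo s w j, hi s w j]"
  by (simp add: trail_def)

lemma hd_trail [simp]: "i < j \<Longrightarrow> hd (trail s w i j) = lo s w i"
  by (simp add: trail_Cons)

lemma last_trail [simp]: "i < j \<Longrightarrow> last (trail s w i j) = hi s w (j - 1)"
  using trail_Suc[of i "j - 1" s w] by simp

lemma set_trail: "set (trail s w i j) = (lo s w ` {i..<j}) \<union> (hi s w ` {i..<j})"
  by (auto simp: trail_def)

lemma successively_trail: "w \<noteq> Flat \<Longrightarrow> successively adj (trail s w i j)"
proof (induction j)
  case (Suc j)
  show ?case
  proof (cases "i < j")
    case True
    then show ?thesis
      using Suc adj_hi_lo[of w s "j - 1"]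
      by (simp add: trail_Suc successively_append_iff adj_lo_hi)
  next
    case False
    then show ?thesis
      by (cases "i = j") (simp_all add: trail_Suc adj_lo_hi)
  qed
qed simp

lemma linked_trail:
  assumes "i \<le> k" "Suc k < j"
  shows "linked (hi s w k) (lo s w (Suc k)) (trail s w i j)"
proof -
  have "trail s w i j = trail s w i k @ [lo s w k] @ [hi s w k, lo s w (Suc k)] @ hi s w (Suc k) # trail s w (Suc (Suc k)) j"
  proof -
    have "trail s w k j = [lo s w k] @ [hi s w k, lo s w (Suc k)] @ hi s w (Suc k) # trail s w (Suc (Suc k)) j"
      using assms by (simp add: trail_Cons)
    then show ?thesis using assms trail_append[of i k j s w] by simp
  qed
  moreover have "linked (hi s w k) (lo s w (Suc k)) [hi s w k, lo s w (Suc k)]"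
    by (simp add: linked_def)
  ultimately show ?thesis by (metis linked_append1 linked_append2)
qed

section \<open>Rotation classes and the period of a cycle\<close>

definition verts_over :: "dyck set \<Rightarrow> bool list set" where
  "verts_over W = {low s w | s w. w \<in> W} \<union> {high s w | s w. w \<in> W}"

definition orb :: "dyck \<Rightarrow> dyck set" where
  "orb w = range (\<lambda>k. (rot ^^ k) w)"

lemma verts_over_Un: "verts_over (A \<union> B) = verts_over A \<union> verts_over B"
  by (auto simp: verts_over_def)

lemma self_in_orb [simp]: "w \<in> orb w"
  unfolding orb_def by (rule range_eqI[of _ _ 0]) simp

lemma rot_orb: "v \<in> orb w \<Longrightarrow> rot v \<in> orb w"
proof -
  assume "v \<in> orb w"
  then obtain k where "v = (rot ^^ k) w" by (auto simp: orb_def)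
  then have "rot v = (rot ^^ Suc k) w" by simp
  then show ?thesis unfolding orb_def by (rule range_eqI)
qed

lemma size_orb: "v \<in> orb w \<Longrightarrow> size v = size w"
  by (auto simp: orb_def)

lemma rot_period_mult: "(rot ^^ (2 * size w * k)) w = w"
  by (induction k) (simp_all add: funpow_add rot_period)

text \<open>In place of an inverse of \<open>rot\<close>, further rotations lead on to a multiple of
  the period.\<close>

lemma orb_sym:
  assumes "v \<in> orb w" shows "w \<in> orb v"
proof (cases "size w = 0")
  case True
  then have "w = Flat" "v = Flat" using size_orb[OF assms] by (cases w; cases v; simp)+
  then show ?thesis by simp
next
  case False
  from assms obtain k where k: "v = (rot ^^ k) w" by (auto simp: orb_def)
  have "k \<le> 2 * size w * k" using False by simp
  then have "(rot ^^ (2 * size w * k - k)) v = w"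
    using rot_period_mult[of w k] funpow_add[of "2 * size w * k - k" k rot] by (simp add: k)
  then show ?thesis unfolding orb_def by (metis rangeI)
qed

lemma orb_closed: "rot ` W \<subseteq> W \<Longrightarrow> w \<in> W \<Longrightarrow> orb w \<subseteq> W"
proof
  fix v assume W: "rot ` W \<subseteq> W" "w \<in> W" and "v \<in> orb w"
  then obtain k where "v = (rot ^^ k) w" by (auto simp: orb_def)
  moreover have "(rot ^^ k) w \<in> W" by (induction k) (use W in auto)
  ultimately show "v \<in> W" by simp
qed

lemma verts_over_disjoint:
  assumes "A \<inter> B = {}" "\<And>w. w \<in> A \<union> B \<Longrightarrow> size w = n"
  shows "verts_over A \<inter> verts_over B = {}"
  using assms unfolding verts_over_def by (auto dest!: low_eqD high_eqD dest: low_neq_high low_neq_high[THEN not_sym])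

text \<open>\<open>L\<close> is the least number of steps after which both the word and the shift
  modulo \<open>2 * size w + 1\<close> recur, so the cycle has \<open>2 * L\<close> vertices. It
  meets every shift of every word of the class because \<open>2 * size w\<close>, a period of the
  word, is coprime to the modulus.\<close>

lemma ex_period:
  assumes "w \<noteq> Flat"
  obtains L where "L > 0" "Suc (2 * size w) dvd L" "(rot ^^ L) w = w"
    "\<And>s i. distinct (trail s w i (i + L))"
    "\<And>s i. set (trail s w i (i + L)) = verts_over (orb w)"
    "\<And>k. k > 0 \<Longrightarrow> Suc (2 * size w) dvd k \<Longrightarrow> (rot ^^ k) w = w \<Longrightarrow> L \<le> k"
proof -
  let ?N = "Suc (2 * size w)"
  let ?P = "\<lambda>L. L > 0 \<and> ?N dvd L \<and> (rot ^^ L) w = w"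
  define L where "L = (LEAST L. ?P L)"
  have "?P (2 * size w * ?N)"
  proof (intro conjI)
    show "2 * size w * ?N > 0" using assms by (cases w) simp_all
  qed (simp_all only: dvd_triv_right rot_period_mult)
  then have L: "?P L" unfolding L_def by (rule LeastI)
  have min: "\<not> ?P k" if "k < L" for k
    using that unfolding L_def by (rule not_less_Least)
  \<comment> \<open>A repetition at distance less than \<open>L\<close> would contradict the
    minimality of \<open>L\<close>.\<close>
  have eqD: "i = j" if eq: "(rot ^^ i) w = (rot ^^ j) w" "(s + i) mod ?N = (s + j) mod ?N"
    and "a \<le> i" "i \<le> j" "j < a + L" for i j s a
  proof (rule ccontr)
    assume "i \<noteq> j"
    have "(rot ^^ i) w = (rot ^^ i) ((rot ^^ (j - i)) w)"
      using eq(1) \<open>i \<le> j\<close> funpow_add[of i "j - i" rot] by simp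
    then have "(rot ^^ (j - i)) w = w"
      using inj_fn[OF inj_rot, of i] by (metis injD)
    moreover have "?N dvd j - i"
      using eq(2) \<open>i \<le> j\<close> by (metis add_diff_cancel_left mod_eq_dvd_iff_nat nat_add_left_cancel_le)
    moreover have "0 < j - i" "j - i < L"
      using that(3-5) \<open>i \<noteq> j\<close> by linarith+
    ultimately show False using min[of "j - i"] by blast
  qed
  have inj: "inj_on (lo s w) {a..<a + L}" "inj_on (hi s w) {a..<a + L}" for s a
  proof -
    have *: "i = j" if e: "(rot ^^ i) w = (rot ^^ j) w" "(s + i) mod ?N = (s + j) mod ?N"
      and m: "i \<in> {a..<a + L}" "j \<in> {a..<a + L}" for i j
    proof (cases "i \<le> j")
      case True
      show ?thesis by (rule eqD[OF e _ True, of a]) (use m in simp_all)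
    next
      case False
      have "j = i" by (rule eqD[OF e(1)[symmetric] e(2)[symmetric], of a]) (use m False in simp_all)
      then show ?thesis by simp
    qed
    show "inj_on (lo s w) {a..<a + L}"
    proof (rule inj_onI)
      fix i j assume m: "i \<in> {a..<a + L}" "j \<in> {a..<a + L}" and "lo s w i = lo s w j"
      then show "i = j"
        using low_eqD[of "s + i" "(rot ^^ i) w" "s + j" "(rot ^^ j) w"] *[OF _ _ m] by (simp add: lo_def)
    qed
    show "inj_on (hi s w) {a..<a + L}"
    proof (rule inj_onI)
      fix i j assume m: "i \<in> {a..<a + L}" "j \<in> {a..<a + L}" and "hi s w i = hi s w j"
      then show "i = j"
        using high_eqD[of "s + i" "(rot ^^ i) w" "s + j" "(rot ^^ j) w"] *[OF _ _ m] by (simp add: hi_def)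
    qed
  qed
  have dist: "distinct (trail s w i j)" if "j \<le> i + L" for s i j
    using that
  proof (induction j)
    case (Suc j)
    show ?case
    proof (cases "i \<le> j")
      case True
      have "lo s w j \<notin> lo s w ` {i..<j}" "hi s w j \<notin> hi s w ` {i..<j}"
        using inj_on_image_mem_iff[OF inj(1)[of s i], of j "{i..<j}"]
          inj_on_image_mem_iff[OF inj(2)[of s i], of j "{i..<j}"] Suc.prems True by auto
      moreover have "lo s w k \<noteq> hi s w k'" "hi s w k' \<noteq> lo s w k" for k k'
        unfolding lo_def hi_def by (metis low_neq_high size_rot_funpow)+
      ultimately show ?thesis
        using Suc True by (auto simp: trail_Suc set_trail)
    qed simp
  qed simp
  have "set (trail s w i (i + L)) = verts_over (orb w)" for s i
  proof
    show "set (trail s w i (i + L)) \<subseteq> verts_over (orb w)"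
    proof -
      have "(rot ^^ k) w \<in> orb w" for k by (simp add: orb_def)
      then show ?thesis unfolding set_trail lo_def hi_def verts_over_def by blast
    qed
    have "\<exists>k\<in>{i..<i + L}. low t ((rot ^^ j) w) = lo s w k \<and> high t ((rot ^^ j) w) = hi s w k" for t j
    proof -
      define M where "M = 2 * size w"
      \<comment> \<open>the Chinese remainder theorem for the coprime moduli \<open>M\<close> and \<open>M + 1\<close>\<close>
      define m where "m = j + M * (s + j + M * t)"
      obtain M' where M': "M = Suc M'"
        using assms unfolding M_def by (cases w) auto
      \<comment> \<open>Since \<open>M\<close> is -1 modulo \<open>M + 1\<close>, the sum
        \<open>s + m\<close> reduces to \<open>t\<close>; \<open>M'\<close> stands for
        \<open>M - 1\<close>.\<close>
      have "s + m = ((s + j) + M' * t) * Suc M + t"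
        by (simp add: m_def M' algebra_simps)
      then have m: "(s + m) mod ?N = t mod ?N"
        unfolding M_def by (metis mod_mult_self3)
      \<comment> \<open>The index in the window that is congruent to \<open>m\<close> modulo
        \<open>L\<close>; the summand \<open>L * i\<close> keeps the subtraction of \<open>i\<close>
        from truncating.\<close>
      define k where "k = i + (m + L * i - i) mod L"
      have "i \<le> L * i" using L by simp
      then have km: "k mod L = m mod L"
        unfolding k_def mod_add_right_eq by (metis le_add_diff_inverse mod_mult_self2 trans_le_add2)
      have "(rot ^^ k) w = (rot ^^ m) w"
        using km L by (metis funpow_mod_eq)
      also have "\<dots> = (rot ^^ j) w"
        by (simp add: m_def M_def funpow_add rot_period_mult)
      finally have "(rot ^^ k) w = (rot ^^ j) w" .
      moreover have "(s + k) mod ?N = t mod ?N"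
        using km L m by (metis mod_add_right_eq mod_mod_cancel)
      moreover have "k \<in> {i..<i + L}" using L by (simp add: k_def)
      ultimately show ?thesis
        using low_high_cong[of "s + k" "(rot ^^ j) w" t]
        unfolding lo_def hi_def by (intro bexI[of _ k]) simp_all
    qed
    then show "verts_over (orb w) \<subseteq> set (trail s w i (i + L))"
      unfolding set_trail verts_over_def orb_def by fast
  qed
  moreover have "L \<le> k" if "k > 0" "?N dvd k" "(rot ^^ k) w = w" for k
    using min[of k] that by (meson not_less)
  ultimately show ?thesis using L dist by (intro that[of L]) simp_all
qed

section \<open>Splicing cycles into a path\<close>

lemma lo_hi_period:
  assumes "Suc (2 * size w) dvd L" "(rot ^^ L) w = w"
  shows "lo s w (i + L) = lo s w i" "hi s w (i + L) = hi s w i"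
proof -
  have "(rot ^^ (i + L)) w = (rot ^^ i) w"
    using assms(2) by (simp add: funpow_add)
  moreover have "(s + (i + L)) mod Suc (2 * size w) = (s + i) mod Suc (2 * size w)"
    using assms(1) by (elim dvdE) (simp only: add.assoc[symmetric] mod_mult_self2)
  ultimately show "lo s w (i + L) = lo s w i" "hi s w (i + L) = hi s w i"
    using low_high_cong[of "s + (i + L)" "(rot ^^ i) w" "s + i"] by (simp_all add: lo_def hi_def)
qed

text \<open>Used to see that a reserved edge survives when a full turn of a cycle is shortened to
  the indices from \<open>a\<close> to \<open>b\<close>: \<open>gap\<close> says that every index
  where the edge can start lies in that range, short of its end.\<close>

lemma linked_trail_level:
  assumes W: "set (trail s w i (i + L)) = verts_over (orb w)" 
    and v: "v \<in> orb w" and i: "i \<le> a" and j: "i + L = Suc b"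
    and gap: "\<And>k. i \<le> k \<Longrightarrow> k < i + L \<Longrightarrow> (s + k) mod Suc (2 * size w) = t mod Suc (2 * size w) \<Longrightarrow>
      (rot ^^ k) w = v \<Longrightarrow> a \<le> k \<and> k < b"
  shows "linked (high t v) (low (Suc t) (rot v)) (trail s w a (Suc b))"
proof -
  have "high t v \<in> set (trail s w i (i + L))"
    using W v by (auto simp: verts_over_def)
  moreover have "high t v \<noteq> lo s w k" for k
    using size_orb[OF v] low_neq_high[of "(rot ^^ k) w" v "s + k" t] by (simp add: lo_def)
  ultimately obtain k where k: "i \<le> k" "k < i + L" "high t v = hi s w k"
    by (auto simp: set_trail)
  then have "v = (rot ^^ k) w" "(s + k) mod Suc (2 * size w) = t mod Suc (2 * size w)"
    using high_eqD[of t v "s + k" "(rot ^^ k) w"] size_orb[OF v] by (simp_all add: hi_def)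
  moreover from this have "low (Suc t) (rot v) = lo s w (Suc k)"
    unfolding lo_def using mod_Suc_eq
    by (intro trans[OF low_high_cong(1)[of "Suc t" "rot v" "s + Suc k"]]) (simp, metis mod_Suc_eq, simp)
  ultimately show ?thesis
    using gap[OF k(1,2)] linked_trail[of a k "Suc b" s w] k(3) by simp
qed

text \<open>The last conjunct reserves, for every word whose cycle is still missing, the edge into which that
  cycle can be spliced. All these edges lie at level 4, away from the edges that the paths on the
  cycle of the star remove.\<close>

definition covers :: "nat \<Rightarrow> bool list list \<Rightarrow> dyck set \<Rightarrow> bool" where
  "covers n P W \<longleftrightarrow> W \<subseteq> {w. size w = n} \<and> rot ` W \<subseteq> W \<and>
     distinct P \<and> successively adj P \<and> set P = verts_over W \<and>
     (\<forall>u v. Arch (Arch u v) Flat \<in> W \<longrightarrow> Arch u (Arch v Flat) \<notin> W \<longrightarrow>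
        linked (high 4 (Arch (Arch u v) Flat)) (low 5 (rot (Arch (Arch u v) Flat))) P)"

text \<open>The edge of \<open>y\<close> at level 4 is one of the hexagon. It is replaced by a
  detour over all of the cycle of \<open>x\<close>, entered and left by the hexagon edges
  \<open>hexagon(1)\<close> and \<open>hexagon(2)\<close>.\<close>

lemma insert_orbit:
  fixes u v :: dyck
  defines "x \<equiv> Arch u (Arch v Flat)" and "y \<equiv> Arch (Arch u v) Flat"
  assumes P: "covers n P W" and y: "y \<in> W" and x: "x \<notin> W"
  shows "\<exists>P'. covers n P' (W \<union> orb x) \<and> hd P' = hd P \<and> last P' = last P"
proof -
  have sz: "size x = n" "n \<ge> 2"
    using P y unfolding covers_def x_def y_def by auto
  have "x \<noteq> Flat" by (simp add: x_def)
  then obtain L where L: "L > 0" "Suc (2 * n) dvd L" "(rot ^^ L) x = x"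
    and dist: "\<And>s i. distinct (trail s x i (i + L))"
    and set: "\<And>s i. set (trail s x i (i + L)) = verts_over (orb x)"
    using ex_period[of x] sz by metis
  \<comment> \<open>\<open>L\<close> is a positive multiple of \<open>2 * n + 1\<close>, so the
    indices 1 to 4 used below belong to a single turn.\<close>
  have "L \<ge> 5" using L(1,2) sz(2) by (auto dest!: dvd_imp_le)
  have disj: "W \<inter> orb x = {}"
    using P x orb_closed[of W] orb_sym unfolding covers_def by blast
  have disj': "verts_over W \<inter> verts_over (orb x) = {}"
    using P size_orb[of _ x] sz by (intro verts_over_disjoint[of _ _ n] disj) (auto simp: covers_def)
  let ?l = "lo 4 x" and ?h = "hi 4 x"
  \<comment> \<open>the cycle of \<open>x\<close> without two of its edges, closed up by the hexagon edge from \<open>?l 1\<close> to \<open>?h 3\<close>\<close>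
  define C where "C = [?l 3, ?h 2, ?l 2, ?h 1, ?l 1, ?h 3] @ trail 4 x 4 (Suc L)"
  have "trail 4 x 1 (1 + L) = [?l 1, ?h 1, ?l 2, ?h 2, ?l 3, ?h 3] @ trail 4 x 4 (Suc L)"
    using \<open>L \<ge> 5\<close> by (simp add: trail_Cons numeral_eq_Suc)
  then have "mset C = mset (trail 4 x 1 (1 + L))"
    by (simp add: C_def)
  then have C: "distinct C" "set C = verts_over (orb x)"
    using dist[of 4 1] set[of 4 1] by (metis mset_eq_imp_distinct_iff, metis mset_eq_setD)
  have "successively adj C"
  proof -
    have "adj (?l 3) (?h 2)" "adj (?l 2) (?h 1)" "adj (?h 3) (?l 4)"
      using adj_hi_lo[OF \<open>x \<noteq> Flat\<close>, of 4 2] adj_hi_lo[OF \<open>x \<noteq> Flat\<close>, of 4 1]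
        adj_hi_lo[OF \<open>x \<noteq> Flat\<close>, of 4 3] by (simp_all add: adj_commute numeral_eq_Suc)
    moreover have "adj (?h i) (?l i)" for i
      by (rule adj_sym[OF adj_lo_hi])
    moreover have "adj (?l 1) (?h 3)"
      using hexagon(3)[of 4 u v] by (simp add: lo_def hi_def x_def)
    moreover have "successively adj (trail 4 x 4 (Suc L))"
      by (rule successively_trail) fact
    ultimately show ?thesis
      using \<open>L \<ge> 5\<close> by (simp add: C_def successively_append_iff successively_Cons)
  qed
  have C_ends: "C \<noteq> []" "adj (high 4 y) (hd C)" "adj (last C) (low 5 (rot y))"
  proof -
    show "C \<noteq> []" by (simp add: C_def)
    show "adj (high 4 y) (hd C)"
      using hexagon(1)[of 4 u v] by (simp add: C_def lo_def x_def y_def)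
    \<comment> \<open>Index \<open>L\<close> is index 0 again, one full turn later.\<close>
    have "last C = hi 4 x (0 + L)" using \<open>L \<ge> 5\<close> by (simp add: C_def)
    also have "\<dots> = high 4 x"
      using lo_hi_period(2)[of x L 4 0] L sz by (simp add: hi_def)
    finally show "adj (last C) (low 5 (rot y))"
      using hexagon(2)[of 4 u v] by (simp add: x_def y_def)
  qed
  have C_links: "linked (high 4 y') (low 5 (rot y')) C" if "y' \<in> orb x" "y' \<noteq> x" for y'
  proof -
    have "linked (high 4 y') (low (Suc 4) (rot y')) (trail 4 x 4 (Suc L))"
    proof (rule linked_trail_level[where i = 1])
      show "set (trail 4 x 1 (1 + L)) = verts_over (orb x)" by (rule set)
      fix k assume k: "1 \<le> k" "k < 1 + L" "(4 + k) mod Suc (2 * size x) = 4 mod Suc (2 * size x)" "(rot ^^ k) x = y'"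
      \<comment> \<open>Level 4 recurs at multiples of \<open>2 * n + 1\<close> only, hence not at
        the indices 1 to 3 rearranged in \<open>C\<close>; index \<open>L\<close> belongs to
        \<open>x\<close> itself.\<close>
      have "Suc (2 * n) dvd k"
        using k(3) sz(1) by (metis add_diff_cancel_left' le_add1 mod_eq_dvd_iff_nat)
      then have "k \<ge> 5" using k(1) sz(2) by (auto dest!: dvd_imp_le)
      moreover have "k \<noteq> L" using k(4) L(3) that(2) by auto
      ultimately show "4 \<le> k \<and> k < L" using k(2) by simp
    qed (use that in simp_all)
    then show ?thesis unfolding C_def by (simp add: linked_append2 del: append_Cons)
  qed
  have P': "distinct P" "successively adj P" "set P = verts_over W" "W \<subseteq> {w. size w = n}" "rot ` W \<subseteq> W"
    and P_links: "\<And>u v. Arch (Arch u v) Flat \<in> W \<Longrightarrow> Arch u (Arch v Flat) \<notin> W \<Longrightarrow>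
        linked (high 4 (Arch (Arch u v) Flat)) (low 5 (rot (Arch (Arch u v) Flat))) P"
    using P unfolding covers_def by blast+
  have "linked (high 4 y) (low 5 (rot y)) P"
    using P_links x y unfolding x_def y_def by blast
  then obtain a b ys zs where split: "P = ys @ a # b # zs"
    and ab: "(a, b) = (high 4 y, low 5 (rot y)) \<or> (a, b) = (low 5 (rot y), high 4 y)"
    by (rule linked_split)
  \<comment> \<open>The path may traverse the edge in either direction, and the detour is reversed
    accordingly.\<close>
  define D where "D = (if a = high 4 y then C else rev C)"
  have neq: "high 4 y \<noteq> low 5 (rot y)" by (metis low_neq_high size_rot)
  have D: "distinct D" "set D = verts_over (orb x)" "D \<noteq> []" "successively adj D"
    using C \<open>successively adj C\<close> C_ends(1) by (auto simp: D_def simp del: successively_rev)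
  have D_ends: "adj a (hd D)" "adj (last D) b"
    using ab C_ends neq by (auto simp: D_def hd_rev last_rev adj_commute)
  have D_links: "linked p q D \<longleftrightarrow> linked p q C" for p q
    by (simp add: D_def linked_rev)
  let ?P = "ys @ a # D @ b # zs"
  have "covers n ?P (W \<union> orb x)"
    unfolding covers_def
  proof (intro conjI allI impI)
    show "W \<union> orb x \<subseteq> {w. size w = n}"
      using P'(4) size_orb[of _ x] sz by auto
    show "rot ` (W \<union> orb x) \<subseteq> W \<union> orb x"
      using P'(5) rot_orb by auto
    show "distinct ?P"
      using P'(1,3) D(1,2) disj' by (auto simp: split)
    show "set ?P = verts_over (W \<union> orb x)"
      using P'(3) D(2) by (auto simp: split verts_over_Un)
    show "successively adj ?P"
      using P'(2) D(3,4) D_ends by (auto simp: split successively_append_iff successively_Cons)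
    fix u' v' assume mem: "Arch (Arch u' v') Flat \<in> W \<union> orb x" and nmem: "Arch u' (Arch v' Flat) \<notin> W \<union> orb x"
    let ?y = "Arch (Arch u' v') Flat"
    show "linked (high 4 ?y) (low 5 (rot ?y)) ?P"
    proof (cases "?y \<in> W")
      case True
      \<comment> \<open>The edge just used up is not reserved any more, because its partner
        \<open>x\<close> is now covered.\<close>
      have "?y \<noteq> y" using nmem self_in_orb[of x] by (auto simp: x_def y_def)
      moreover have sizes: "size ?y = n" "size y = n"
        using P'(4) True y by blast+
      ultimately have "high 4 ?y \<noteq> high 4 y"
        using high_eqD[of 4 ?y 4 y] by metis
      moreover have "high 4 ?y \<noteq> low 5 (rot y)"
        using sizes by (metis low_neq_high size_rot)
      ultimately show ?thesis
        using P_links[OF True] nmem D(3) ab unfolding split by (intro linked_insert) auto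
    next
      case False
      then have "linked (high 4 ?y) (low 5 (rot ?y)) D"
        using mem C_links[of ?y] by (simp add: D_links x_def)
      then have "linked (high 4 ?y) (low 5 (rot ?y)) ((ys @ [a]) @ D @ b # zs)"
        by (intro linked_append1 linked_append2)
      then show ?thesis by simp
    qed
  qed
  moreover have "hd ?P = hd P" "last ?P = last P"
    by (simp_all add: split hd_append)
  ultimately show ?thesis by blast
qed

text \<open>A missing word of least area is pulled to a word of smaller area, which is therefore
  covered; so the missing cycle can be spliced in. The number of missing words decreases.\<close>

lemma extend_cover:
  assumes "covers n P W" "star n \<in> W"
  shows "\<exists>P'. covers n P' {w. size w = n} \<and> hd P' = hd P \<and> last P' = last P"
  using assms
proof (induction "card ({w. size w = n} - W)" arbitrary: P W rule: less_induct)
  case less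
  have sub: "W \<subseteq> {w. size w = n}" and closed: "rot ` W \<subseteq> W"
    using less.prems unfolding covers_def by blast+
  show ?case
  proof (cases "W = {w. size w = n}")
    case True
    then show ?thesis using less.prems by blast
  next
    case False
    then obtain w0 where "size w0 = n \<and> w0 \<notin> W" using sub by blast
    then obtain w where w: "size w = n" "w \<notin> W"
      and min: "\<And>v. size v = n \<Longrightarrow> v \<notin> W \<Longrightarrow> area w \<le> area v"
      using ex_has_least_nat[of "\<lambda>w. size w = n \<and> w \<notin> W" w0 area] by blast
    have "w \<noteq> star (size w)" using w less.prems by auto
    then obtain k u v w' where k: "(rot ^^ k) w = Arch u (Arch v Flat)"
      "(rot ^^ k) w' = Arch (Arch u v) Flat" "size w' = size w" "area w' < area w"
      using pull by blast
    have "w' \<in> W" using min[of w'] k w by force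
    moreover have "Arch (Arch u v) Flat \<in> orb w'"
      unfolding orb_def k(2)[symmetric] by (rule rangeI)
    ultimately have y: "Arch (Arch u v) Flat \<in> W"
      using orb_closed[OF closed] by blast
    have "Arch u (Arch v Flat) \<in> orb w"
      unfolding orb_def k(1)[symmetric] by (rule rangeI)
    then have "w \<in> orb (Arch u (Arch v Flat))"
      by (rule orb_sym)
    then have x: "Arch u (Arch v Flat) \<notin> W"
      using orb_closed[OF closed] w by blast
    let ?x = "Arch u (Arch v Flat)"
    obtain P' where P': "covers n P' (W \<union> orb ?x)" "hd P' = hd P" "last P' = last P"
      using insert_orbit[OF less.prems(1) y x] by blast
    have "?x \<in> {w. size w = n}" using k(1) w(1) size_rot_funpow[of k w] by simp
    then have "{w. size w = n} - (W \<union> orb ?x) \<subset> {w. size w = n} - W"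
      using x self_in_orb[of ?x] by blast
    then have "card ({w. size w = n} - (W \<union> orb ?x)) < card ({w. size w = n} - W)"
      by (intro psubset_card_mono finite_Diff finite_dyck)
    from less.hyps[OF this P'(1)] show ?thesis using P' less.prems by auto
  qed
qed

section \<open>Paths on the cycle of the star\<close>

text \<open>Besides the cycle edges, the vertices over the star have the chords \<open>adj_chord\<close> between
  \<open>l (2 j)\<close> and \<open>h (2 j + 2)\<close>. Both functions below walk on cycle edges and chords.\<close>

fun fold_path :: "(nat \<Rightarrow> 'a) \<Rightarrow> (nat \<Rightarrow> 'a) \<Rightarrow> nat \<Rightarrow> nat \<Rightarrow> 'a list" where
  "fold_path l h m 0 = [l (2 * m), h (2 * m)]"
| "fold_path l h m (Suc k) =
     l (2 * m) # rev (fold_path l h (Suc m) k) @ [h (2 * m + 1), l (2 * m + 1), h (2 * m)]"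

fun zigzag :: "(nat \<Rightarrow> 'a) \<Rightarrow> (nat \<Rightarrow> 'a) \<Rightarrow> bool \<Rightarrow> nat \<Rightarrow> nat \<Rightarrow> 'a list" where
  "zigzag l h b m 0 = [if b then l (2 * m) else h (2 * m)]"
| "zigzag l h b m (Suc k) =
     (if b then [l (2 * m), h (2 * m - 1), l (2 * m - 1)] else [h (2 * m)]) @ zigzag l h (\<not> b) (m - 1) k"

lemma fold_path_ends [simp]: "fold_path l h m k \<noteq> []"
  "hd (fold_path l h m k) = l (2 * m)" "last (fold_path l h m k) = h (2 * m)"
  by (cases k; simp)+

text \<open>The fold path visits a whole block of cycle indices although both its ends sit at the
  first index: chords lead inwards and cycle edges lead back, one fold inside another.\<close>

lemma mset_fold_path:
  "mset (fold_path (lo s w) (hi s w) m k) = mset (trail s w (2 * m) (Suc (2 * (m + k))))"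
proof (induction k arbitrary: m)
  case (Suc k)
  then show ?case by (simp add: trail_Cons)
qed (simp add: trail_Cons)

lemma zigzag_Nil [simp]: "zigzag l h b m k \<noteq> []"
  and hd_zigzag [simp]: "hd (zigzag l h b m k) = (if b then l (2 * m) else h (2 * m))"
  by (cases k; simp)+

lemma last_zigzag: "k \<le> m \<Longrightarrow>
    last (zigzag l h b m k) = (if b = even k then l (2 * (m - k)) else h (2 * (m - k)))"
  by (induction l h b m k rule: zigzag.induct) auto

text \<open>The two zigzags are complementary: at each stage one takes three cycle vertices while
  the other jumps along a chord, and then they exchange roles.\<close>

lemma mset_zigzag: "k \<le> m \<Longrightarrow>
    mset (zigzag (lo s w) (hi s w) True m k) + mset (zigzag (lo s w) (hi s w) False m k)
      = mset (trail s w (2 * (m - k)) (Suc (2 * m)))"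
proof (induction k arbitrary: m)
  case (Suc k)
  then obtain m' where m: "m = Suc m'" by (cases m) auto
  have "trail s w (2 * (m' - k)) (Suc (2 * m)) = trail s w (2 * (m' - k)) (Suc (2 * m'))
      @ [lo s w (2 * m' + 1), hi s w (2 * m' + 1), lo s w (2 * m), hi s w (2 * m)]"
    by (simp add: m trail_Suc)
  then show ?case using Suc.IH[of m'] Suc.prems by (simp add: m ac_simps)
qed (simp add: trail_Cons)

lemma rot2_star: "rot (rot (star k)) = star k"
  by (cases k) simp_all

lemma rot_even_star: "(rot ^^ (2 * j)) (star k) = star k"
  by (induction j) (simp_all add: rot2_star)

lemma orb_star: "orb (star (Suc k)) = {star (Suc k), Arch Flat (star k)}"
proof
  show "orb (star (Suc k)) \<subseteq> {star (Suc k), Arch Flat (star k)}"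
    by (rule orb_closed) auto
  have "rot (star (Suc k)) \<in> orb (star (Suc k))"
    by (rule rot_orb) simp
  then show "{star (Suc k), Arch Flat (star k)} \<subseteq> orb (star (Suc k))"
    using self_in_orb by auto
qed

lemma lo_even_star: "lo 0 (star n) (2 * j) = low (2 * j) (star n)"
  and hi_even_star: "hi 0 (star n) (2 * j) = high (2 * j) (star n)"
  by (simp_all add: lo_def hi_def rot_even_star)

lemma adj_chord: "adj (lo 0 (star n) (2 * j)) (hi 0 (star n) (2 * Suc j))"
  unfolding lo_even_star hi_even_star using adj_low_high_star[of "2 * j" n] by simp

lemma star_neq_Flat [simp]: "n > 0 \<Longrightarrow> star n \<noteq> Flat"
  by (cases n) auto

text \<open>\<open>rot\<close> has order exactly 2 on the star once \<open>n\<close> is at least 2,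
  and \<open>2 * n + 1\<close> is odd, so the period is their product.\<close>

lemma star_period:
  assumes "n \<ge> 2"
  shows "distinct (trail 0 (star n) 1 (Suc (2 * Suc (2 * n))))"
    and "set (trail 0 (star n) 1 (Suc (2 * Suc (2 * n)))) = verts_over (orb (star n))"
proof -
  have "star n \<noteq> Flat" using assms by simp
  then obtain L where L: "L > 0" "Suc (2 * n) dvd L" "(rot ^^ L) (star n) = star n"
    "\<And>s i. distinct (trail s (star n) i (i + L))"
    "\<And>s i. set (trail s (star n) i (i + L)) = verts_over (orb (star n))"
    "\<And>k. k > 0 \<Longrightarrow> Suc (2 * n) dvd k \<Longrightarrow> (rot ^^ k) (star n) = star n \<Longrightarrow> L \<le> k"
    using ex_period[of "star n"] by (metis size_star)
  have "even L"
  proof (rule ccontr)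
    assume "odd L"
    then have "(rot ^^ L) (star n) = rot (star n)"
      by (elim oddE) (simp add: rot_even_star)
    then show False using L(3) assms by (cases n; cases "n - 1") auto
  qed
  then have "2 * Suc (2 * n) dvd L"
    using L(2) by (intro divides_mult) (simp_all add: coprime_left_2_iff_odd)
  then have "2 * Suc (2 * n) \<le> L" using L(1) by (rule dvd_imp_le)
  moreover have "L \<le> 2 * Suc (2 * n)"
    by (rule L(6)) (simp_all only: rot_even_star dvd_triv_right, simp)
  ultimately have "L = 2 * Suc (2 * n)" by simp
  then show "distinct (trail 0 (star n) 1 (Suc (2 * Suc (2 * n))))"
    and "set (trail 0 (star n) 1 (Suc (2 * Suc (2 * n)))) = verts_over (orb (star n))"
    using L(4)[of 0 1] L(5)[of 0 1] by simp_all
qed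

lemma hi_top_star: "hi 0 (star n) (2 * Suc (2 * n)) = hi 0 (star n) 0"
  and lo_top_star: "lo 0 (star n) (2 * Suc (2 * n)) = lo 0 (star n) 0"
proof -
  have "Suc (2 * size (star n)) dvd 2 * Suc (2 * n)"
    by (simp only: size_star dvd_triv_right)
  from lo_hi_period[OF this rot_even_star, of 0 0]
  show "hi 0 (star n) (2 * Suc (2 * n)) = hi 0 (star n) 0"
    "lo 0 (star n) (2 * Suc (2 * n)) = lo 0 (star n) 0"
    by (simp_all only: add_0)
qed

lemma successively_fold_path:
  assumes "n > 0"
  shows "successively adj (fold_path (lo 0 (star n)) (hi 0 (star n)) m k)"
proof (induction k arbitrary: m)
  case (Suc k)
  have "adj (hi 0 (star n) (2 * m + 1)) (lo 0 (star n) (2 * Suc m))" 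
    "adj (hi 0 (star n) (2 * m)) (lo 0 (star n) (2 * m + 1))"
    using adj_hi_lo[of "star n" 0 "2 * m + 1"] adj_hi_lo[of "star n" 0 "2 * m"] assms by simp_all
  then show ?case
    using Suc[of "Suc m"] adj_chord[of n m]
    by (simp add: successively_append_iff successively_Cons hd_rev last_rev
        adj_sym adj_lo_hi[THEN adj_sym] del: successively_rev)
qed (simp add: adj_lo_hi)

lemma successively_zigzag:
  assumes "n > 0" "k \<le> m"
  shows "successively adj (zigzag (lo 0 (star n)) (hi 0 (star n)) b m k)"
  using assms(2)
proof (induction k arbitrary: m b)
  case (Suc k)
  then obtain m' where m: "m = Suc m'" by (cases m) auto
  have "adj (hi 0 (star n) (2 * m' + 1)) (lo 0 (star n) (2 * Suc m'))" 
    "adj (hi 0 (star n) (2 * m')) (lo 0 (star n) (2 * m' + 1))"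
    using adj_hi_lo[of "star n" 0 "2 * m' + 1"] adj_hi_lo[of "star n" 0 "2 * m'"] assms by simp_all
  then show ?case
    using Suc adj_chord[of n m']
    by (auto simp add: m successively_append_iff successively_Cons
        adj_sym adj_lo_hi[THEN adj_sym])
qed simp

text \<open>The class of the star consists of \<open>star n\<close> and
  \<open>Arch Flat (star (n - 1))\<close>. Only \<open>star n\<close> has the form relevant for
  \<open>covers\<close>, so a single edge has to be kept.\<close>

lemma star_link:
  assumes "Arch (Arch u v) Flat \<in> orb (star n)" "n \<ge> 2" "linked (hi 0 (star n) 4) (lo 0 (star n) 5) P"
  shows "linked (high 4 (Arch (Arch u v) Flat)) (low 5 (rot (Arch (Arch u v) Flat))) P"
proof -
  obtain k where n: "n = Suc (Suc k)" using assms(2) by (metis le_add_diff_inverse add_2_eq_Suc)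
  then have "Arch (Arch u v) Flat = star n"
    using assms(1) unfolding n orb_star by auto
  moreover have "hi 0 (star n) 4 = high 4 (star n)" "lo 0 (star n) 5 = low 5 (rot (star n))"
    using rot_even_star[of 2 n] by (simp_all add: hi_def lo_def numeral_eq_Suc)
  ultimately show ?thesis using assms(3) by simp
qed

lemma covers_star:
  assumes "n \<ge> 2" "mset P = mset (trail 0 (star n) 1 (Suc (2 * Suc (2 * n))))"
    "successively adj P" "linked (hi 0 (star n) 4) (lo 0 (star n) 5) P"
  shows "covers n P (orb (star n))"
  unfolding covers_def
proof (intro conjI allI impI)
  show "distinct P" using star_period(1)[OF assms(1)] assms(2) mset_eq_imp_distinct_iff by blast
  show "set P = verts_over (orb (star n))"
    using star_period(2)[OF assms(1)] assms(2) mset_eq_setD by blast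
qed (use assms size_orb rot_orb star_link in auto)

lemma linked_trail_star:
  "i \<le> 4 \<Longrightarrow> 5 < j \<Longrightarrow> linked (hi 0 (star n) 4) (lo 0 (star n) 5) (trail 0 (star n) i j)"
  using linked_trail[of i 4 j 0 "star n"] by simp

text \<open>The path follows the cycle from index 1 up to index \<open>2 * m - 1\<close> and then
  folds over the rest, up to index \<open>2 * (2 * n + 1)\<close>. Its ends have distance
  \<open>2 * k + 1\<close> by \<open>ham_near\<close>.\<close>

lemma root_path_near:
  assumes "n \<ge> 2" "k < n"
  shows "\<exists>P. covers n P (orb (star n)) \<and> hd P = low 1 (rot (star n))
    \<and> last P = high (2 * (2 * n + 1 - k)) (star n)"
proof -
  define m where "m = Suc (2 * n) - k"
  have m: "m + k = Suc (2 * n)" "m \<ge> 4" using assms by (simp_all add: m_def)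
  let ?P = "trail 0 (star n) 1 (2 * m) @ fold_path (lo 0 (star n)) (hi 0 (star n)) m k"
  have "covers n ?P (orb (star n))"
  proof (rule covers_star)
    have "trail 0 (star n) 1 (2 * m) @ trail 0 (star n) (2 * m) (Suc (2 * (m + k)))
        = trail 0 (star n) 1 (Suc (2 * (m + k)))"
      using m by (intro trail_append) simp_all
    then show "mset ?P = mset (trail 0 (star n) 1 (Suc (2 * Suc (2 * n))))"
      unfolding m(1)[symmetric] by (metis mset_append mset_fold_path)
    have "adj (hi 0 (star n) (2 * m - 1)) (lo 0 (star n) (2 * m))"
      using adj_hi_lo[of "star n" 0 "2 * m - 1"] m assms by simp
    then show "successively adj ?P"
      using m assms successively_trail[of "star n"] successively_fold_path[of n]
      by (simp add: successively_append_iff)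
    show "linked (hi 0 (star n) 4) (lo 0 (star n) 5) ?P"
      using m by (intro linked_append1 linked_trail_star) simp_all
  qed fact
  moreover have "hd ?P = low 1 (rot (star n))"
    using m by (simp add: hd_append lo_def)
  moreover have "last ?P = high (2 * m) (star n)"
    by (simp add: hi_even_star del: mult_Suc_right)
  ultimately show ?thesis unfolding m_def by (metis Suc_eq_plus1)
qed

text \<open>One zigzag leads from index \<open>2 * N\<close> down to \<open>2 * n + 2\<close>, the
  cycle leads on down to index 1, and the other zigzag starts again at \<open>2 * N\<close>, which
  is index 0. For even \<open>n\<close> the zigzags end at a low and a high vertex respectively, so
  that the pieces fit.\<close>

lemma root_path_antipodal_even:
  assumes "n \<ge> 2" "even n"
  shows "\<exists>P. covers n P (orb (star n)) \<and> hd P = low 0 (star n) \<and> last P = high 1 (star n)"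
proof -
  define N where "N = Suc (2 * n)"
  let ?l = "lo 0 (star n)" and ?h = "hi 0 (star n)"
  let ?z = "\<lambda>b. zigzag ?l ?h b N n"
  let ?P = "?z True @ rev (trail 0 (star n) 1 (2 * Suc n)) @ ?z False"
  have N: "N - n = Suc n" "n \<le> N" by (simp_all add: N_def)
  have "covers n ?P (orb (star n))"
  proof (rule covers_star)
    have "trail 0 (star n) 1 (2 * Suc n) @ trail 0 (star n) (2 * Suc n) (Suc (2 * N))
        = trail 0 (star n) 1 (Suc (2 * N))"
      by (intro trail_append) (simp_all add: N_def)
    then show "mset ?P = mset (trail 0 (star n) 1 (Suc (2 * Suc (2 * n))))"
      using mset_zigzag[OF N(2), of 0 "star n"] unfolding N(1) N_def[symmetric]
      by (metis mset_append mset_rev add.assoc add.commute)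
    have "adj (?l (2 * Suc n)) (?h (2 * n + 1))" 
      using adj_hi_lo[of "star n" 0 "2 * n + 1"] assms by (simp add: adj_sym)
    moreover have "adj (?l 1) (?h (2 * N))"
      using adj_hi_lo[of "star n" 0 0] assms hi_top_star[of n] by (simp add: N_def adj_sym)
    ultimately show "successively adj ?P"
      using assms successively_trail[of "star n"] successively_zigzag[of n n N] N
      by (simp add: successively_append_iff hd_rev last_rev last_zigzag successively_adj_rev del: successively_rev)
    show "linked (?h 4) (?l 5) ?P"
      using assms by (intro linked_append1 linked_append2) (simp add: linked_rev linked_trail_star)
  qed fact
  moreover have "hd ?P = low 0 (star n)"
    using lo_top_star[of n] by (simp add: N_def lo_def)
  moreover have "last ?P = high 1 (star n)"
  proof -
    have "last ?P = high (2 * Suc n) (star n)"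
      using assms N by (simp add: last_zigzag hi_even_star del: mult_Suc_right)
    also have "\<dots> = high 1 (star n)"
    proof (rule low_high_cong(2))
      have "2 * Suc n = 1 + Suc (2 * n)" by simp
      then show "2 * Suc n mod Suc (2 * size (star n)) = 1 mod Suc (2 * size (star n))"
        by (simp only: size_star mod_add_self2)
    qed
    finally show ?thesis .
  qed
  ultimately show ?thesis by blast
qed

lemma root_path_antipodal_odd:
  assumes "n \<ge> 2" "odd n"
  shows "\<exists>P W. covers n P W \<and> star n \<in> W \<and> hd P = low 0 (star n) \<and> last P = high 1 (star n)"
proof -
  define N where "N = Suc (2 * n)"
  \<comment> \<open>With this level the hexagon has the edges from \<open>?h (2 * N - 1)\<close> to
    \<open>?l (2 * N)\<close>, on the path, and from \<open>?l 2\<close> to \<open>?h 2\<close>, on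
    the separate cycle; its third removed edge lies on the cycle of \<open>y\<close>.\<close>
  define s where "s = 2 * N - 1"
  obtain k where n: "n = Suc (Suc k)" using assms(1) by (metis le_add_diff_inverse add_2_eq_Suc)
  have "k \<ge> 1" using assms(2) by (cases k) (auto simp: n)
  define x where "x = Arch Flat (star (Suc k))"
  define y where "y = Arch (Arch Flat (star k)) Flat"
  have rot_S: "rot (star n) = x" by (simp add: n x_def)
  have sizes: "size x = n" "size y = n" by (simp_all add: x_def y_def n)
  have "y \<notin> orb (star n)"
    unfolding n orb_star using \<open>k \<ge> 1\<close> by (cases k) (auto simp: y_def)
  then have disj: "orb (star n) \<inter> orb y = {}"
    using orb_closed[of "orb (star n)" ] orb_sym rot_orb by blast
  have disj': "verts_over (orb (star n)) \<inter> verts_over (orb y) = {}"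
    using size_orb sizes by (intro verts_over_disjoint[of _ _ n] disj) fastforce
  have "y \<noteq> Flat" by (simp add: y_def)
  then obtain L where L: "L > 0" "N dvd L" "(rot ^^ L) y = y"
    and dist: "\<And>s i. distinct (trail s y i (i + L))"
    and set: "\<And>s i. set (trail s y i (i + L)) = verts_over (orb y)"
    using ex_period[of y] sizes unfolding N_def by metis
  let ?l = "lo 0 (star n)" and ?h = "hi 0 (star n)"
  let ?z = "\<lambda>b. zigzag ?l ?h b N n"
  define D where "D = trail s y 1 (Suc L)"
  define R where "R = ?l 1 # ?h 1 # [?l 2]"
  \<comment> \<open>The two zigzags form a path and a disjoint cycle; one hexagon joins both of them to the cycle of \<open>y\<close>.\<close>
  define P where "P = [?l (2 * N), ?h 2] @ trail 0 (star n) 3 (2 * Suc n) @ rev (?z False) @ R @ rev D @ tl (?z True)"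
  have N: "N - n = Suc n" "n \<le> N" by (simp_all add: N_def)
  have zT: "?z True = ?l (2 * N) # tl (?z True)" "hd (tl (?z True)) = ?h (2 * N - 1)" "tl (?z True) \<noteq> []"
    by (simp_all add: n)
  have "trail 0 (star n) 1 (Suc (2 * N)) = trail 0 (star n) 1 3 @ trail 0 (star n) 3 (2 * Suc n) @ trail 0 (star n) (2 * Suc n) (Suc (2 * N))"
    using assms by (simp add: trail_append N_def)
  moreover have "mset (trail 0 (star n) 1 3) = mset R + {#?h 2#}"
    by (simp add: R_def trail_Cons numeral_eq_Suc)
  moreover have "mset (trail 0 (star n) (2 * Suc n) (Suc (2 * N)))
      = add_mset (?l (2 * N)) (mset (tl (?z True))) + mset (?z False)"
    using mset_zigzag[OF N(2), of 0 "star n"] zT(1) by (metis N(1) mset.simps(2))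
  ultimately have mset: "mset P = mset (trail 0 (star n) 1 (Suc (2 * N)) @ D)"
    by (simp add: P_def)
  have link: "linked (?h 4) (?l 5) P"
  proof -
    have "linked (?h 4) (?l 5) (trail 0 (star n) 3 (2 * Suc n))"
      using assms by (intro linked_trail_star) simp_all
    then show ?thesis by (simp only: P_def linked_append1 linked_append2)
  qed
  have "successively adj P"
  proof -
    have top: "?l (2 * N) = ?l 0" "?h (2 * N) = ?h 0"
      using hi_top_star[of n] lo_top_star[of n] by (simp_all add: N_def)
    have S0: "star n \<noteq> Flat" using assms by simp
    \<comment> \<open>This chord is the hexagon edge \<open>hexagon(3)\<close> at level
      \<open>s\<close>.\<close>
    have a1: "adj (?l (2 * N)) (?h 2)"
      unfolding top using adj_chord[of n 0] by (simp add: numeral_2_eq_2)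
    have a2: "adj (?h 2) (?l 3)" "adj (?h (2 * n + 1)) (?l (2 * Suc n))" "adj (?l 1) (?h (2 * N))" "adj (?h 1) (?l 2)"
      unfolding top
      using adj_hi_lo[OF S0, of 0 2] adj_hi_lo[OF S0, of 0 "2 * n + 1"] adj_hi_lo[OF S0, of 0 0] adj_hi_lo[OF S0, of 0 1]
      by (simp_all add: adj_sym numeral_eq_Suc)
    have "low (s + 3) ((rot ^^ 3) x) = ?l 2"
    proof -
      have "(rot ^^ 3) x = star n"
        using rot_even_star[of 2 n] by (simp add: numeral_eq_Suc flip: rot_S)
      moreover have "low (s + 3) (star n) = low 2 (star n)"
      proof (rule low_high_cong(1))
        have "s + 3 = 2 + 2 * N" by (simp add: s_def N_def)
        then show "(s + 3) mod Suc (2 * size (star n)) = 2 mod Suc (2 * size (star n))"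
          by (simp only: size_star N_def[symmetric] mod_mult_self1 mod_mult_self3 mod_mult_self2 mod_mult_self4)
      qed
      ultimately show ?thesis using lo_even_star[of n 1] by simp
    qed
    then have a3: "adj (high s y) (?l 2)"
      using hexagon(1)[of s Flat "star k"] by (simp add: x_def y_def)
    have "high s x = ?h (2 * N - 1)"
    proof -
      have s: "s = Suc (2 * (2 * n))" by (simp add: s_def N_def)
      show ?thesis using rot_even_star[of "2 * n" n] rot_S unfolding s_def[symmetric] hi_def by (simp add: s)
    qed
    then have a4: "adj (?h (2 * N - 1)) (low (Suc s) (rot y))"
      using hexagon(2)[of s Flat "star k"] by (simp add: x_def y_def)
    have D: "D \<noteq> []" "hd D = low (Suc s) (rot y)" "last D = high s y" "successively adj D"
    proof -
      have "last D = hi s y (0 + L)" using L(1) by (simp add: D_def)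
      also have "\<dots> = hi s y 0"
        using L sizes by (intro lo_hi_period) (simp_all add: N_def)
      finally show "last D = high s y" by (simp add: hi_def)
    qed (use L(1) \<open>y \<noteq> Flat\<close> in \<open>simp_all add: D_def lo_def successively_trail\<close>)
    have zz: "successively adj (?z False)" "successively adj (tl (?z True))"
    proof -
      have "successively adj (tl xs)" if "successively adj xs" for xs
        using that by (cases xs) (auto simp: successively_Cons)
      moreover have "successively adj (?z b)" for b
        using N(2) assms(1) by (intro successively_zigzag) simp_all
      ultimately show "successively adj (?z False)" "successively adj (tl (?z True))"
        by blast+
    qed
    have z: "hd (rev (?z False)) = ?l (2 * Suc n)" "last (rev (?z False)) = ?h (2 * N)"
      using assms(2) N by (simp_all add: hd_rev last_rev last_zigzag)
    have tr: "successively adj (trail 0 (star n) 3 (2 * Suc n))" "hd (trail 0 (star n) 3 (2 * Suc n)) = ?l 3"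
      "last (trail 0 (star n) 3 (2 * Suc n)) = ?h (2 * n + 1)" "trail 0 (star n) 3 (2 * Suc n) \<noteq> []"
      using assms S0 by (simp_all add: successively_trail)
    have R: "successively adj R" "R \<noteq> []" "hd R = ?l 1" "last R = ?l 2"
      using a2(4) by (simp_all add: R_def adj_lo_hi)
    have "successively adj (rev D @ tl (?z True))"
      using D zz(2) zT(2,3) a4 by (simp add: successively_append_iff last_rev successively_adj_rev adj_commute del: successively_rev)
    moreover have "hd (rev D @ tl (?z True)) = high s y"
      using D by (simp add: hd_append hd_rev)
    ultimately have "successively adj (R @ rev D @ tl (?z True))"
      using R a3 by (subst successively_append_iff) (simp add: adj_commute)
    moreover have "hd (R @ rev D @ tl (?z True)) = ?l 1" by (simp add: R_def)
    ultimately have "successively adj (rev (?z False) @ R @ rev D @ tl (?z True))"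
      using zz(1) z a2(3) R(2) by (subst successively_append_iff) (simp add: successively_adj_rev adj_commute del: successively_rev)
    then have "successively adj (trail 0 (star n) 3 (2 * Suc n) @ rev (?z False) @ R @ rev D @ tl (?z True))"
      using tr z(1) a2(2) by (subst successively_append_iff) (simp add: hd_append)
    then show ?thesis
      using a1 a2(1) tr(2,4) unfolding P_def
      by (subst successively_append_iff) (simp add: hd_append)
  qed
  have cover: "covers n P (orb (star n) \<union> orb y)"
    unfolding covers_def
  proof (intro conjI allI impI)
    have "distinct (trail 0 (star n) 1 (Suc (2 * N)) @ D)"
      using star_period[OF assms(1)] dist[of s 1] set[of s 1] disj' by (simp add: N_def D_def)
    then show "distinct P" using mset mset_eq_imp_distinct_iff by blast
    show "set P = verts_over (orb (star n) \<union> orb y)"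
      using mset_eq_setD[OF mset] star_period(2)[OF assms(1)] set[of s 1]
      by (simp add: N_def D_def verts_over_Un)
    show "orb (star n) \<union> orb y \<subseteq> {w. size w = n}"
      using size_orb sizes by fastforce
    show "rot ` (orb (star n) \<union> orb y) \<subseteq> orb (star n) \<union> orb y"
      using rot_orb by auto
    fix u v assume mem: "Arch (Arch u v) Flat \<in> orb (star n) \<union> orb y"
    let ?y = "Arch (Arch u v) Flat"
    show "linked (high 4 ?y) (low 5 (rot ?y)) P"
    proof (cases "?y \<in> orb (star n)")
      case True
      then show ?thesis using star_link assms(1) link by blast
    next
      case False
      have "linked (high 4 ?y) (low (Suc 4) (rot ?y)) (trail s y 1 (Suc L))"
      proof (rule linked_trail_level[where i = 1])
        show "set (trail s y 1 (1 + L)) = verts_over (orb y)" by (rule set)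
        show "?y \<in> orb y" using mem False by blast
        fix j assume j: "1 \<le> j" "j < 1 + L" "(s + j) mod Suc (2 * size y) = 4 mod Suc (2 * size y)"
        have "N \<ge> 7" using \<open>k \<ge> 1\<close> by (simp add: N_def n)
        \<comment> \<open>The edge removed from the cycle of \<open>y\<close> has level -1 modulo
          \<open>N\<close>, which differs from 4 since \<open>N\<close> is at least 7.\<close>
        have "j \<noteq> L"
        proof
          assume "j = L"
          then obtain c where "j = N * c" using L(2) by (auto elim: dvdE)
          then have "s + j = (N - 1) + N * (c + 1)" using \<open>N \<ge> 7\<close> by (simp add: s_def)
          then have "(s + j) mod N = N - 1" using \<open>N \<ge> 7\<close> by (simp only: mod_mult_self2) simp
          then show False using j(3) \<open>N \<ge> 7\<close> sizes by (simp add: N_def)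
        qed
        then show "1 \<le> j \<and> j < L" using j by simp
      qed simp_all
      then have "linked (high 4 ?y) (low 5 (rot ?y)) (rev D)"
        by (simp add: D_def linked_rev)
      then show ?thesis by (simp only: P_def linked_append1 linked_append2)
    qed
  qed (rule \<open>successively adj P\<close>)
  have "hd P = low 0 (star n)"
    using lo_top_star[of n] by (simp add: P_def N_def lo_def)
  moreover have "last P = high 1 (star n)"
  proof -
    have "last P = last (?z True)" using zT(3) zT(1) by (simp add: P_def) (metis last_ConsR)
    also have "\<dots> = high (2 * Suc n) (star n)"
      using assms N by (simp add: last_zigzag hi_even_star del: mult_Suc_right)
    also have "\<dots> = high 1 (star n)"
    proof (rule low_high_cong(2))
      have "2 * Suc n = 1 + Suc (2 * n)" by simp
      then show "2 * Suc n mod Suc (2 * size (star n)) = 1 mod Suc (2 * size (star n))"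
        by (simp only: size_star mod_add_self2)
    qed
    finally show ?thesis .
  qed
  ultimately show ?thesis using cover by (meson UnI1 self_in_orb)
qed

section \<open>Hamming distance and symmetry\<close>

fun ham :: "bool list \<Rightarrow> bool list \<Rightarrow> nat" where
  "ham (a # x) (b # y) = of_bool (a \<noteq> b) + ham x y"
| "ham _ _ = 0"

lemma ham_append: "length x = length y \<Longrightarrow> ham (x @ x') (y @ y') = ham x y + ham x' y'"
  by (induction x y rule: list_induct2) auto

lemma ham_same [simp]: "ham x x = 0"
  by (induction x) auto

lemma ham_le_length: "ham x y \<le> length x"
  by (induction x y rule: ham.induct) (auto split: if_splits)

lemma ham_sym: "ham x y = ham y x"
  by (induction x y rule: ham.induct) (auto split: list.splits)

lemma ham_triangle: "length x = length y \<Longrightarrow> length y = length z \<Longrightarrow> ham x z \<le> ham x y + ham y z"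
  by (induction x y z rule: list_induct3) auto

lemma even_ham: "length x = length y \<Longrightarrow> even (ham x y + weight x + weight y)"
  by (induction x y rule: list_induct2) auto

lemma ham_eq_0: "length x = length y \<Longrightarrow> ham x y = 0 \<Longrightarrow> x = y"
  by (induction x y rule: list_induct2) auto

lemma adj_iff_ham: "adj x y \<longleftrightarrow> length x = length y \<and> ham x y = 1"
proof
  show "adj x y \<Longrightarrow> length x = length y \<and> ham x y = 1"
    by (auto simp: adj_def ham_append)
  assume "length x = length y \<and> ham x y = 1"
  then have "length x = length y" "ham x y = 1" by auto
  then show "adj x y"
  proof (induction x y rule: list_induct2)
    case (Cons a x b y)
    show ?case
    proof (cases "a = b")
      case True
      then obtain p c q where "x = p @ c # q" "y = p @ (\<not> c) # q"
        using Cons by (auto simp: adj_def)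
      then show ?thesis using adjI[of "a # p" c q] True by simp
    next
      case False
      then have "x = y" "b = (\<not> a)" using Cons ham_eq_0 by auto
      then show ?thesis using adjI[of "[]" a x] by simp
    qed
  qed simp
qed

lemma ham_conv_mset: "ham x y = size {#ab \<in># mset (zip x y). fst ab \<noteq> snd ab#}"
  by (induction x y rule: ham.induct) auto

text \<open>Length, the two weights and the distance determine how often each of the four pairs of
  bits occurs. Hence some coordinate permutation maps one pair of strings to the other.\<close>

lemma zip_mset_unique:
  assumes "length x = N" "length y = N" "length x' = N" "length y' = N"
    and "weight x = weight x'" "weight y = weight y'" "ham x y = ham x' y'"
  shows "mset (zip x y) = mset (zip x' y')"
proof (rule multiset_eqI)
  let ?c = "\<lambda>x y a b. count (mset (zip x y)) (a, b)"
  have *: "weight x = ?c x y True True + ?c x y True False"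
    "weight y = ?c x y True True + ?c x y False True"
    "ham x y = ?c x y True False + ?c x y False True"
    "length x = ?c x y True True + ?c x y True False + ?c x y False True + ?c x y False False"
    if "length x = length y" for x y
    using that by (induction x y rule: list_induct2) auto
  fix ab :: "bool \<times> bool"
  obtain a b where "ab = (a, b)" by (cases ab)
  then show "count (mset (zip x y)) ab = count (mset (zip x' y')) ab"
    using *[of x y] *[of x' y'] assms by (cases a; cases b) simp_all
qed

lemma ham_star: "ham (False # word (star k)) (word (star k) @ [True]) = 2 * k + 1"
  by (induction k) (simp_all add: word_star_Suc del: star.simps(2))

lemma ham_near_end: "ham (low 1 (rot (star (Suc (Suc k))))) (high 3 (star (Suc (Suc k)))) = 2 * k + 3"
proof -
  let ?w = "word (star (Suc k))"
  have "low 1 (rot (star (Suc (Suc k)))) = (True # ?w) @ [False, False]"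
    by (simp add: low_def)
  moreover have "high 3 (star (Suc (Suc k))) = (?w @ [True]) @ [True, False]"
    by (simp add: high_def numeral_eq_Suc word_star_Suc del: star.simps)
  moreover have "ham ((True # ?w) @ [False, False]) ((?w @ [True]) @ [True, False])
      = ham (True # ?w) (?w @ [True]) + ham [False, False] [True, False]"
    by (rule ham_append) simp
  ultimately have "ham (low 1 (rot (star (Suc (Suc k))))) (high 3 (star (Suc (Suc k))))
      = ham (True # ?w) (?w @ [True]) + 1"
    by (simp only: ham.simps) simp
  then show ?thesis using ham_star[of k] by (simp add: word_star_Suc del: star.simps)
qed

text \<open>Each increase of \<open>k\<close> moves the end over two edges, so the distance changes
  by at most 2. It is 1 at \<open>k = 0\<close> and \<open>2 * n - 1\<close> at
  \<open>k = n - 1\<close>, so every change in between is exactly +2.\<close>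

lemma ham_near:
  assumes "n \<ge> 2" "k < n"
  shows "ham (low 1 (rot (star n))) (high (2 * (2 * n + 1 - k)) (star n)) = 2 * k + 1"
proof -
  let ?f = "\<lambda>k. ham (low 1 (rot (star n))) (high (2 * (2 * n + 1 - k)) (star n))"
  have step: "?f (Suc k) \<le> ?f k + 2" "?f k \<le> ?f (Suc k) + 2" if "k < n" for k
  proof -
    define j where "j = 2 * (2 * n + 1 - Suc k)"
    have j: "2 * (2 * n + 1 - k) = j + 2" using that by (simp add: j_def)
    have "adj (low j (star n)) (high j (star n))" "adj (low j (star n)) (high (j + 2) (star n))"
      by (rule adj_low_high, rule adj_low_high_star)
    then have "ham (high j (star n)) (high (j + 2) (star n)) \<le> 2"
      using ham_triangle[of "high j (star n)" "low j (star n)" "high (j + 2) (star n)"]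
        ham_sym[of "high j (star n)" "low j (star n)"] by (simp add: adj_iff_ham)
    then show "?f (Suc k) \<le> ?f k + 2" "?f k \<le> ?f (Suc k) + 2"
      unfolding j j_def[symmetric]
      using ham_triangle[of "low 1 (rot (star n))" "high (j + 2) (star n)" "high j (star n)"]
        ham_triangle[of "low 1 (rot (star n))" "high j (star n)" "high (j + 2) (star n)"]
        ham_sym[of "high j (star n)" "high (j + 2) (star n)"] by simp_all
  qed
  have "high (2 * (2 * n + 1 - 0)) (star n) = high 0 (star n)"
  proof (rule low_high_cong(2))
    have "2 * (2 * n + 1 - 0) = Suc (2 * n) * 2" by simp
    then show "2 * (2 * n + 1 - 0) mod Suc (2 * size (star n)) = 0 mod Suc (2 * size (star n))"
      by (simp only: size_star mod_mult_self1_is_0 mod_0)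
  qed
  then have "?f 0 = 1"
    using adj_high_low[of "star n" 0] assms by (simp add: adj_iff_ham ham_sym)
  then have upper: "?f k \<le> 2 * k + 1" if "k \<le> n" for k
    using that
  proof (induction k)
    case (Suc k)
    then show ?case using step(1)[of k] by simp
  qed simp
  have lower: "?f (k + i) \<le> ?f k + 2 * i" if "k + i \<le> n" for k i
    using that
  proof (induction i)
    case (Suc i)
    then show ?case using step(1)[of "k + i"] by simp
  qed simp
  obtain m where n: "n = Suc (Suc m)" using assms(1) by (metis le_add_diff_inverse add_2_eq_Suc)
  have "high (2 * (2 * n + 1 - (n - 1))) (star n) = high 3 (star n)"
  proof (rule low_high_cong(2))
    have "2 * (2 * n + 1 - (n - 1)) = 3 + Suc (2 * n)" using assms by simp
    then show "2 * (2 * n + 1 - (n - 1)) mod Suc (2 * size (star n)) = 3 mod Suc (2 * size (star n))"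
      by (simp only: size_star mod_add_self2)
  qed
  then have "?f (n - 1) = 2 * m + 3"
    using ham_near_end[of m] unfolding n by simp
  then show ?thesis
    using upper[of k] lower[of k "n - 1 - k"] assms by (simp add: n)
qed

lemma ham_antipodal: "ham (low 0 (star n)) (high 1 (star n)) = 2 * n + 1"
  using ham_star[of n] by (simp add: low_def high_def)

section \<open>The middle levels and their Hamilton paths\<close>

definition middle :: "nat \<Rightarrow> bool list set" where
  "middle n = {x. length x = 2 * n + 1 \<and> (weight x = n \<or> weight x = n + 1)}"

lemma finite_middle: "finite (middle n)"
  by (rule finite_subset[OF _ finite_lists_length_eq[of UNIV "2 * n + 1"]]) (auto simp: middle_def)

lemma weight_map_Not: "weight (map Not x) + weight x = length x"
  by (induction x) auto

lemma verts_over_all: "verts_over {w. size w = n} = middle n"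
proof
  show "verts_over {w. size w = n} \<subseteq> middle n"
    by (auto simp: verts_over_def middle_def)
  let ?N = "Suc (2 * n)"
  let ?A = "{x. length x = ?N \<and> weight x = n}" and ?B = "{x. length x = ?N \<and> weight x = Suc n}"
  let ?Q = "{..<?N} \<times> {w :: dyck. size w = n}"
  have fin: "finite ?A" "finite ?B"
    by (rule finite_subset[OF _ finite_middle[of n]]; auto simp: middle_def)+
  have low: "?A = (\<lambda>(s, w). low s w) ` ?Q"
  proof
    show "?A \<subseteq> (\<lambda>(s, w). low s w) ` ?Q"
    proof
      fix x assume "x \<in> ?A"
      then obtain s w where "size w = n" "x = low s w" using ex_low[of x n] by blast
      then show "x \<in> (\<lambda>(s, w). low s w) ` ?Q"
        by (intro image_eqI[of _ _ "(s mod ?N, w)"]) (simp_all add: low_high_cong(1)[of s w "s mod ?N"])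
    qed
  qed auto
  have "card ?Q = card ?A"
    unfolding low by (intro card_image[symmetric] inj_onI) (auto dest!: low_eqD)
  \<comment> \<open>Only the lower level is parsed directly. Complementation shows that the upper
    level is equally large, and \<open>high\<close> is injective on the same index set, so it is
    onto.\<close>
  also have "card ?A = card ?B"
    by (rule bij_betw_same_card[of "map Not"], rule bij_betwI[where g = "map Not"])
       (auto simp: comp_def dest: sym intro!: map_idI, (metis weight_map_Not add_right_cancel add_Suc mult_2 length_map add.commute)+)
  also have "card ?Q = card ((\<lambda>(s, w). high s w) ` ?Q)"
    by (intro card_image[symmetric] inj_onI) (auto dest!: high_eqD)
  finally have high: "?B = (\<lambda>(s, w). high s w) ` ?Q"
    by (intro card_subset_eq[symmetric] fin) auto
  show "middle n \<subseteq> verts_over {w. size w = n}"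
  proof
    fix x assume "x \<in> middle n"
    then have "x \<in> ?A \<or> x \<in> ?B" by (auto simp: middle_def)
    then show "x \<in> verts_over {w. size w = n}"
      unfolding low high verts_over_def by auto
  qed
qed

lemma hamilton_path_middle:
  assumes n: "n \<ge> 2" and u: "length u = 2 * n + 1" "weight u = n" and v: "length v = 2 * n + 1" "weight v = n + 1"
  shows "\<exists>P. distinct P \<and> successively adj P \<and> set P = middle n \<and> hd P = u \<and> last P = v"
proof -
  \<comment> \<open>The weights differ by 1, and the distance has the parity of their sum.\<close>
  have "odd (ham u v)" using even_ham[of u v] u v by presburger
  then obtain k where k: "ham u v = 2 * k + 1" by (elim oddE)
  have "k \<le> n" using ham_le_length[of u v] u k by simp
  have "\<exists>P W. covers n P W \<and> star n \<in> W \<and> size (hd P) = 2 * n + 1 \<and> size (last P) = 2 * n + 1 \<and>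
      weight (hd P) = n \<and> weight (last P) = n + 1 \<and> ham (hd P) (last P) = 2 * k + 1"
  proof (cases "k = n")
    case True
    have "\<exists>P W. covers n P W \<and> star n \<in> W \<and> hd P = low 0 (star n) \<and> last P = high 1 (star n)"
      using root_path_antipodal_even[OF n] root_path_antipodal_odd[OF n] self_in_orb by blast
    then show ?thesis using ham_antipodal[of n] True by (metis length_low length_high weight_low weight_high size_star Suc_eq_plus1)
  next
    case False
    then have "k < n" using \<open>k \<le> n\<close> by simp
    then obtain P where "covers n P (orb (star n))" "hd P = low 1 (rot (star n))"
      "last P = high (2 * (2 * n + 1 - k)) (star n)"
      using root_path_near[OF n] by blast
    then show ?thesis using ham_near[OF n \<open>k < n\<close>] self_in_orb
      by (metis length_low length_high weight_low weight_high size_star size_rot Suc_eq_plus1)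
  qed
  then obtain P0 W where P0: "covers n P0 W" "star n \<in> W" and ends: "length (hd P0) = 2 * n + 1"
    "length (last P0) = 2 * n + 1" "weight (hd P0) = n" "weight (last P0) = n + 1"
    "ham (hd P0) (last P0) = 2 * k + 1"
    by blast
  obtain P where P: "covers n P {w. size w = n}" "hd P = hd P0" "last P = last P0"
    using extend_cover[OF P0] by blast
  then have P': "distinct P" "successively adj P" "set P = middle n"
    unfolding covers_def verts_over_all by blast+
  \<comment> \<open>The Hamilton path has ends at the required distance; a permutation of
    coordinates moves them to \<open>u\<close> and \<open>v\<close>.\<close>
  have "mset (zip u v) = mset (zip (hd P) (last P))"
    using ends k u v P(2,3) by (intro zip_mset_unique) simp_all
  then obtain p where "p permutes {..<length (zip (hd P) (last P))}"
    and "permute_list p (zip (hd P) (last P)) = zip u v"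
    by (rule mset_eq_permutation)
  then have p: "p permutes {..<2 * n + 1}"
    and uv: "zip (permute_list p (hd P)) (permute_list p (last P)) = zip u v"
    using ends P(2,3) by (simp_all add: permute_list_zip)
  let ?f = "permute_list p"
  have "?f (hd P) = u" "?f (last P) = v"
    using uv ends P(2,3) u v by (metis length_permute_list map_fst_zip, metis length_permute_list map_snd_zip)
  have inj: "inj_on ?f (middle n)"
  proof (rule inj_onI)
    fix x y assume xy: "x \<in> middle n" "y \<in> middle n" "?f x = ?f y"
    show "x = y"
    proof (rule nth_equalityI)
      show "length x = length y" using xy by (simp add: middle_def)
      fix i assume "i < length x"
      then have i: "i < 2 * n + 1" using xy by (simp add: middle_def)
      then obtain j where "i = p j" "j < 2 * n + 1"
        using permutes_image[OF p] by (metis imageE lessThan_iff)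
      then show "x ! i = y ! i"
        using xy p by (metis (mono_tags, lifting) middle_def mem_Collect_eq permute_list_nth)
    qed
  qed
  have into: "?f ` middle n \<subseteq> middle n"
  proof
    fix y assume "y \<in> ?f ` middle n"
    then obtain x where x: "x \<in> middle n" "y = ?f x" by blast
    then have "mset y = mset x" using p by (simp add: middle_def)
    then have "weight y = weight x" unfolding weight_def by (metis count_mset)
    then show "y \<in> middle n" using x by (simp add: middle_def)
  qed
  have "?f ` middle n = middle n"
    using endo_inj_surj[OF finite_middle into inj] .
  then have "set (map ?f P) = middle n" using P'(3) by simp
  moreover have "distinct (map ?f P)" using P'(1,3) inj by (simp add: distinct_map)
  moreover have "successively adj (map ?f P)"
  proof -
    have "adj (?f x) (?f y)" if "x \<in> set P" "y \<in> set P" "adj x y" for x y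
    proof -
      have len: "length x = 2 * n + 1" "length y = 2 * n + 1" using that P'(3) by (simp_all add: middle_def)
      then have "zip (?f x) (?f y) = ?f (zip x y)"
        using p by (simp add: permute_list_zip)
      then have "mset (zip (?f x) (?f y)) = mset (zip x y)"
        using p len by simp
      then show ?thesis
        using that(3) len by (simp add: adj_iff_ham ham_conv_mset)
    qed
    then show ?thesis
      unfolding successively_map using P'(2) by (rule successively_mono[rotated]) 
  qed
  moreover have "P \<noteq> []"
    using P'(3) u by (auto simp: middle_def)
  ultimately show ?thesis
    using \<open>?f (hd P) = u\<close> \<open>?f (last P) = v\<close> by (intro exI[of _ "map ?f P"]) (simp add: hd_map last_map)
qed

section \<open>Strings over two symbols\<close>

text \<open>The dropped first symbol is forced by the balance: it is 1 precisely when the rest has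
  only \<open>n\<close> ones.\<close>

definition encode :: "nat \<Rightarrow> bool list \<Rightarrow> nat list" where
  "encode n x = (if weight x = n then 1 else 2) # map (\<lambda>b. if b then 1 else 2) x"

definition decode :: "nat list \<Rightarrow> bool list" where
  "decode z = map (\<lambda>a. a = 1) (tl z)"

lemma decode_encode [simp]: "decode (encode n x) = x"
  by (induction x) (simp_all add: decode_def encode_def)

lemma count_list_encode:
  "count_list (map (\<lambda>b. if b then 1 else 2 :: nat) x) 1 = weight x"
  "count_list (map (\<lambda>b. if b then 1 else 2 :: nat) x) 2 = length x - weight x"
proof -
  have "weight x \<le> length x" for x
    by (metis count_le_length weight_def)
  then show "count_list (map (\<lambda>b. if b then 1 else 2 :: nat) x) 1 = weight x"
    "count_list (map (\<lambda>b. if b then 1 else 2 :: nat) x) 2 = length x - weight x"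
    by (induction x) (auto simp: Suc_diff_le)
qed

lemma encode_in_binary_strings: "x \<in> middle n \<Longrightarrow> encode n x \<in> binary_strings (Suc n) (Suc n)"
  unfolding binary_strings_def middle_def encode_def
  by (auto simp: count_list_encode simp del: One_nat_def)

lemma encode_decode:
  assumes "z \<in> binary_strings (Suc n) (Suc n)"
  shows "decode z \<in> middle n" "encode n (decode z) = z" "z ! 0 = 1 \<longleftrightarrow> weight (decode z) = n"
proof -
  obtain c r where z: "z = c # r" using assms by (cases z) (auto simp: binary_strings_def)
  have "c = 1 \<or> c = 2" "set r \<subseteq> {1, 2}" "length r = 2 * n + 1"
    and count: "count_list (c # r) 1 = Suc n"
    using assms unfolding z binary_strings_def by auto
  have "weight (map (\<lambda>a. a = 1) r) = count_list r 1" for r :: "nat list"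
    by (induction r) auto
  then have w: "weight (decode z) = (if c = 1 then n else Suc n)"
    using count by (auto simp: z decode_def)
  have r: "map (\<lambda>b. if b then 1 else 2) (map (\<lambda>a. a = 1) r) = r"
    using \<open>set r \<subseteq> {1, 2}\<close> by (induction r) auto
  show "decode z \<in> middle n"
    using w \<open>length r = 2 * n + 1\<close> by (auto simp: middle_def decode_def z)
  show "z ! 0 = 1 \<longleftrightarrow> weight (decode z) = n"
    using w by (simp add: z)
  show "encode n (decode z) = z"
    using w r \<open>c = 1 \<or> c = 2\<close> by (auto simp: encode_def) (simp_all add: decode_def z)
qed

lemma encode_middle: "encode n ` middle n = binary_strings (Suc n) (Suc n)"
proof
  show "encode n ` middle n \<subseteq> binary_strings (Suc n) (Suc n)"
    using encode_in_binary_strings by blast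
  show "binary_strings (Suc n) (Suc n) \<subseteq> encode n ` middle n"
    using encode_decode(1,2) by (metis image_eqI subsetI)
qed

text \<open>Flipping a bit changes the forced first symbol as well, to the old value of that bit;
  this is a swap of the two entries.\<close>

lemma encode_adj:
  assumes "x \<in> middle n" "y \<in> middle n" "adj x y"
  shows "(encode n x, encode n y) \<in> parcs (star_transposition_graph (Suc n) (Suc n))"
proof -
  obtain p b q where xy: "x = p @ b # q" "y = p @ (\<not> b) # q"
    using assms(3) by (auto simp: adj_def)
  let ?i = "Suc (length p)"
  let ?c = "\<lambda>b. if b then 1 else 2 :: nat"
  have "weight x = (if b then n + 1 else n)" "weight y = (if b then n else n + 1)"
    using assms(1,2) by (cases b; auto simp: middle_def xy)+
  then have e: "encode n x = ?c (\<not> b) # map ?c p @ ?c b # map ?c q"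
    "encode n y = ?c b # map ?c p @ ?c (\<not> b) # map ?c q"
    by (auto simp: encode_def xy)
  have "encode n y = swap_first ?i (encode n x)" "encode n x ! ?i \<noteq> encode n x ! 0"
    "?i \<in> {1..<length (encode n x)}"
    unfolding swap_first_def e by (simp_all add: nth_append list_update_append)
  then show ?thesis
    using encode_in_binary_strings[OF assms(1)] unfolding star_transposition_graph_def by auto
qed

theorem theorem8:
  fixes \<alpha> :: nat
  assumes "\<alpha> \<ge> 3"
  shows "hamilton_laceable (with_proj (star_transposition_graph \<alpha> \<alpha>))
           (first_symbol_class \<alpha> \<alpha> 1) (first_symbol_class \<alpha> \<alpha> 2)"
proof -
  obtain n where \<alpha>: "\<alpha> = Suc n" and n: "n \<ge> 2"
    using assms by (cases \<alpha>) auto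
  let ?G = "with_proj (star_transposition_graph \<alpha> \<alpha>)"
  have verts: "verts ?G = encode n ` middle n"
    by (simp add: \<alpha> encode_middle star_transposition_graph_def)
  have "\<exists>p. hamilton_path ?G u p v"
    if "u \<in> first_symbol_class \<alpha> \<alpha> 1" "v \<in> first_symbol_class \<alpha> \<alpha> 2" for u v
  proof -
    have u: "u \<in> binary_strings (Suc n) (Suc n)" "u ! 0 = 1"
      and v: "v \<in> binary_strings (Suc n) (Suc n)" "v ! 0 = 2"
      using that by (simp_all add: \<alpha> first_symbol_class_def)
    have "length (decode u) = 2 * n + 1" "weight (decode u) = n"
      "length (decode v) = 2 * n + 1" "weight (decode v) = n + 1"
      using encode_decode[OF u(1)] encode_decode[OF v(1)] u(2) v(2) by (auto simp: middle_def)
    then obtain P where P: "distinct P" "successively adj P" "set P = middle n"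
      "hd P = decode u" "last P = decode v"
      using hamilton_path_middle[OF n] by blast
    have "P \<noteq> []" using P(3) encode_decode(1)[OF u(1)] by auto
    have arcs: "set (vwalk_arcs (map (encode n) P)) \<subseteq> arcs_ends ?G"
      using P(2) eq_refl[OF P(3)]
    proof (induction P rule: vwalk_arcs.induct)
      case (3 x y xs)
      then show ?case using encode_adj[of x n y] by (simp add: \<alpha>)
    qed simp_all
    have "inj_on (encode n) (middle n)"
      by (rule inj_on_inverseI[where g = decode]) simp
    then have "vpath (map (encode n) P) ?G"
      unfolding vpath_def vwalk_def verts using arcs P(1,3) \<open>P \<noteq> []\<close> by (simp add: distinct_map)
    moreover have "set (map (encode n) P) = verts ?G"
      unfolding verts using P(3) by simp
    moreover have "hd (map (encode n) P) = u" "last (map (encode n) P) = v"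
      using \<open>P \<noteq> []\<close> P(4,5) encode_decode(2)[OF u(1)] encode_decode(2)[OF v(1)]
      by (simp_all add: hd_map last_map)
    ultimately show ?thesis unfolding hamilton_path_def by blast
  qed
  moreover have "bipartite_with ?G (first_symbol_class \<alpha> \<alpha> 1) (first_symbol_class \<alpha> \<alpha> 2)"
    using assms by (intro bipartite_star_transposition_graph) simp
  ultimately show ?thesis unfolding hamilton_laceable_def by blast
qed

end
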